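(* There is an absolute constant $C$ such that the following holds. Let $n\ge2$ and $0<\varepsilon\le1$ with $n\ge C/\varepsilon^4$. Let $A_1,\dots,A_n$ be elements of a group $G$, and let $A'_1,\dots,A'_n$ be independent identically distributed random variables, each $A'_i$ equal to one of $A_1,\dots,A_n,A_1^{-1},\dots,A_n^{-1}$ with equal probability (i.e. uniformly distributed on this list of $2n$ elements). If $$ \sup_{B\in G}\mathbb{P}(A'_1\cdots A'_n=B) > \frac{1}{\varepsilon\sqrt n},$$ then there is a finite subgroup $H$ of $G$ of order at most $C\varepsilon\sqrt n$ such that $A_i\in H$ for at least $(1-C\varepsilon^2)n$ indices $i\in\{1,\dots,n\}$. *)

theory Defs
  imports "HOL-Probability.Probability" "HOL-Algebra.Group"
begin

text \<open>The list \<open>A\<^sub>1, \<dots>, A\<^sub>n, A\<^sub>1\<inverse>, \<dots>, A\<^sub>n\<inverse>\<close> of \<open>2n\<close> elements is kept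
  as a multiset: repetitions count in the uniform distribution.\<close>

definition signed_elements :: "'g monoid \<Rightarrow> nat \<Rightarrow> (nat \<Rightarrow> 'g) \<Rightarrow> 'g multiset" where
  "signed_elements G n A =
     image_mset A (mset_set {1..n}) + image_mset (\<lambda>i. inv\<^bsub>G\<^esub> (A i)) (mset_set {1..n})"

text \<open>Every \<open>X i\<close> takes its values in the finite set underlying the list, so all events
  below are measurable even when the group is uncountable.\<close>

definition iid_uniform_signed ::
    "'g monoid \<Rightarrow> nat \<Rightarrow> (nat \<Rightarrow> 'g) \<Rightarrow> 'w measure \<Rightarrow> (nat \<Rightarrow> 'w \<Rightarrow> 'g) \<Rightarrow> bool" where
  "iid_uniform_signed G n A M X \<longleftrightarrow>
     prob_space M \<and>
     prob_space.indep_vars M (\<lambda>_. count_space (set_mset (signed_elements G n A))) X {1..n} \<and>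
     (\<forall>i\<in>{1..n}. distr M (count_space UNIV) (X i)
                  = measure_pmf (pmf_of_multiset (signed_elements G n A)))"

definition ordered_prod :: "'g monoid \<Rightarrow> nat \<Rightarrow> (nat \<Rightarrow> 'g) \<Rightarrow> 'g" where
  "ordered_prod G n x = foldr (\<lambda>a b. a \<otimes>\<^bsub>G\<^esub> b) (map x [1..<Suc n]) \<one>\<^bsub>G\<^esub>"

text \<open>\<open>C\<close> is an admissible constant for all groups with elements in \<open>'g\<close> and all
  probability spaces with points in \<open>'w\<close>. HOL cannot quantify over types below
  \<open>\<exists>C\<close>, hence the two type arguments: an absolute constant is a \<open>C\<close>, chosen without
  reference to \<open>'g\<close> and \<open>'w\<close>, that is admissible for every choice of these types. This
  is expressed by the existence of some \<open>C > 0\<close> admissible at the fixed types \<open>nat\<close>, \<open>nat\<close>,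
  together with the claim that any such \<open>C\<close> is admissible at all types.\<close>

definition admissible_constant :: "'g itself \<Rightarrow> 'w itself \<Rightarrow> real \<Rightarrow> bool" where
  "admissible_constant _ _ C \<longleftrightarrow>
     (\<forall>(n::nat) (\<epsilon>::real) (G::'g monoid) (A::nat \<Rightarrow> 'g) (M::'w measure) (X::nat \<Rightarrow> 'w \<Rightarrow> 'g).
        n \<ge> 2 \<longrightarrow> 0 < \<epsilon> \<longrightarrow> \<epsilon> \<le> 1 \<longrightarrow> real n \<ge> C / \<epsilon> ^ 4 \<longrightarrow>
        group G \<longrightarrow> (\<forall>i\<in>{1..n}. A i \<in> carrier G) \<longrightarrow>
        iid_uniform_signed G n A M X \<longrightarrow>
        (SUP B\<in>carrier G. measure M {\<omega> \<in> space M. ordered_prod G n (\<lambda>i. X i \<omega>) = B})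
          > 1 / (\<epsilon> * sqrt (real n)) \<longrightarrow>
        (\<exists>H. subgroup H G \<and> finite H \<and>
             real (card H) \<le> C * \<epsilon> * sqrt (real n) \<and>
             real (card {i \<in> {1..n}. A i \<in> H}) \<ge> (1 - C * \<epsilon>\<^sup>2) * real n))"

end

theory Submission
  imports Defs "HOL-Algebra.Generated_Groups"
begin

text \<open>Let \<open>\<mu>\<close> be the law of one step and \<open>u m\<close> the probability that the walk is at the identity
  after \<open>2m\<close> steps; by symmetry this is \<open>\<Sum>x. (pmf (walk \<mu> m) x)\<^sup>2\<close>, and it bounds every point
  probability of the walk after \<open>2m\<close> steps. Suppose that every subgroup of order at most \<open>K\<close> has
  \<open>\<mu>\<close>-mass below \<open>1 - p\<close>. Then no coset of a subgroup of order at most \<open>K/2\<close> carries more than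
  \<open>1 - p/2\<close>, and after \<open>2k\<close> steps with \<open>k\<close> about \<open>1/p\<close> every such subgroup has mass at most \<open>3/4\<close>.
  The stabilizer of a finite set \<open>S\<close> has at most \<open>card S\<close> elements, so for \<open>card S \<le> K/2\<close> a
  \<open>2k\<close>-step increment moves \<open>S\<close> with probability at least \<open>1/4\<close>. The resulting one-dimensional
  Nash inequality gives \<open>u m - u (m + k) \<ge> c u(m)^3\<close> as long as \<open>u m\<close> exceeds a multiple of \<open>1/K\<close>,
  hence \<open>u m\<close> is at most of order \<open>1 / sqrt (p m)\<close> or \<open>1/K\<close>. Take \<open>K = C \<epsilon> sqrt n\<close>, \<open>p = C \<epsilon>\<^sup>2\<close>.

  The constant can be transferred between types because only the countable subgroup generated by
  the \<open>A i\<close> and the joint law of finitely many finitely valued variables matter.\<close>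

section \<open>Random walks driven by a symmetric finitely supported law\<close>

context group
begin

definition conv_pmf :: "'a pmf \<Rightarrow> 'a pmf \<Rightarrow> 'a pmf" where
  "conv_pmf p q = bind_pmf p (\<lambda>g. map_pmf (\<lambda>x. g \<otimes> x) q)"

text \<open>The new step multiplies on the left, matching the \<open>foldr\<close> in
  \<open>ordered_prod\<close>, where the first factor is the outermost one.\<close>

primrec walk :: "'a pmf \<Rightarrow> nat \<Rightarrow> 'a pmf" where
  "walk \<mu> 0 = return_pmf \<one>"
| "walk \<mu> (Suc k) = conv_pmf \<mu> (walk \<mu> k)"

lemma cancel_inv:
  assumes "g \<in> carrier G" "x \<in> carrier G"
  shows "inv g \<otimes> (g \<otimes> x) = x" "g \<otimes> (inv g \<otimes> x) = x"
  using assms by (simp_all add: m_assoc[symmetric])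

lemma set_conv_pmf: "set_pmf (conv_pmf p q) = (\<Union>g\<in>set_pmf p. (\<lambda>x. g \<otimes> x) ` set_pmf q)"
  by (auto simp: conv_pmf_def)

lemma set_conv_pmf_carrier:
  assumes "set_pmf p \<subseteq> carrier G" "set_pmf q \<subseteq> carrier G"
  shows "set_pmf (conv_pmf p q) \<subseteq> carrier G"
  using assms by (auto simp: set_conv_pmf)

lemma conv_pmf_assoc:
  assumes "set_pmf p \<subseteq> carrier G" "set_pmf q \<subseteq> carrier G" "set_pmf r \<subseteq> carrier G"
  shows "conv_pmf (conv_pmf p q) r = conv_pmf p (conv_pmf q r)"
  unfolding conv_pmf_def map_bind_pmf bind_assoc_pmf bind_map_pmf map_pmf_comp
  by (intro bind_pmf_cong map_pmf_cong refl) (simp add: m_assoc assms[THEN subsetD])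

lemma pmf_map_translate:
  assumes "g \<in> carrier G" "x \<in> carrier G" "set_pmf q \<subseteq> carrier G"
  shows "pmf (map_pmf (\<lambda>y. g \<otimes> y) q) x = pmf q (inv g \<otimes> x)"
proof -
  have "pmf (map_pmf (\<lambda>y. g \<otimes> y) q) x = measure q ((\<lambda>y. g \<otimes> y) -` {x} \<inter> set_pmf q)"
    by (simp add: pmf_map measure_Int_set_pmf)
  also have "(\<lambda>y. g \<otimes> y) -` {x} \<inter> set_pmf q = {inv g \<otimes> x} \<inter> set_pmf q"
    using assms by (auto simp: cancel_inv subset_iff)
  finally show ?thesis by (simp add: measure_Int_set_pmf measure_pmf_single)
qed

lemma pmf_conv:
  assumes "finite (set_pmf p)" "set_pmf p \<subseteq> carrier G" "set_pmf q \<subseteq> carrier G" "x \<in> carrier G"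
  shows "pmf (conv_pmf p q) x = (\<Sum>g\<in>set_pmf p. pmf p g * pmf q (inv g \<otimes> x))"
proof -
  have "pmf (conv_pmf p q) x
      = (\<Sum>g\<in>set_pmf p. pmf p g * pmf (map_pmf (\<lambda>y. g \<otimes> y) q) x)"
    unfolding conv_pmf_def pmf_bind
    by (subst integral_measure_pmf[OF assms(1)]) auto
  then show ?thesis
    using assms by (auto intro!: sum.cong simp: pmf_map_translate subset_iff)
qed

lemma measure_conv_pmf:
  assumes "finite (set_pmf p)"
  shows "measure (measure_pmf (conv_pmf p q)) S
    = (\<Sum>g\<in>set_pmf p. pmf p g * measure (measure_pmf q) ((\<lambda>z. g \<otimes> z) -` S))"
proof -
  have "ennreal (measure (measure_pmf (conv_pmf p q)) S)
      = (\<integral>\<^sup>+g. measure (measure_pmf q) ((\<lambda>z. g \<otimes> z) -` S) \<partial>measure_pmf p)"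
    by (simp add: conv_pmf_def measure_pmf.emeasure_eq_measure[symmetric])
  also have "\<dots> = ennreal (\<Sum>g\<in>set_pmf p. pmf p g * measure (measure_pmf q) ((\<lambda>z. g \<otimes> z) -` S))"
    by (simp add: nn_integral_measure_pmf_finite assms ennreal_mult[symmetric] sum_ennreal mult.commute)
  finally show ?thesis
    by (subst (asm) ennreal_inj) (auto intro!: sum_nonneg)
qed

text \<open>Inversion reverses a product, and two independent draws may be made in either
  order.\<close>

lemma map_inv_conv_pmf:
  assumes "set_pmf p \<subseteq> carrier G" "set_pmf q \<subseteq> carrier G"
  shows "map_pmf (\<lambda>x. inv x) (conv_pmf p q)
       = conv_pmf (map_pmf (\<lambda>x. inv x) q) (map_pmf (\<lambda>x. inv x) p)"
proof -
  have "map_pmf (\<lambda>x. inv x) (conv_pmf p q)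
      = bind_pmf p (\<lambda>g. bind_pmf q (\<lambda>x. return_pmf (inv x \<otimes> inv g)))"
    unfolding conv_pmf_def map_bind_pmf map_pmf_comp map_pmf_def
    by (simp add: bind_assoc_pmf bind_return_pmf,
        intro bind_pmf_cong refl) (use assms in \<open>auto simp: inv_mult_group subset_iff\<close>)
  also have "\<dots> = bind_pmf q (\<lambda>x. bind_pmf p (\<lambda>g. return_pmf (inv x \<otimes> inv g)))"
    by (rule bind_commute_pmf)
  finally show ?thesis
    unfolding conv_pmf_def map_pmf_def by (simp add: bind_assoc_pmf bind_return_pmf)
qed

lemma pmf_inv_symmetric:
  assumes "set_pmf p \<subseteq> carrier G" "map_pmf (\<lambda>x. inv x) p = p" "x \<in> carrier G"
  shows "pmf p (inv x) = pmf p x"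
proof -
  have "pmf p (inv x) = measure p ((\<lambda>x. inv x) -` {inv x} \<inter> set_pmf p)"
    using assms(2) pmf_map[of "\<lambda>x. inv x" p "inv x"] by (simp add: measure_Int_set_pmf)
  also have "(\<lambda>x. inv x) -` {inv x} \<inter> set_pmf p = {x} \<inter> set_pmf p"
    using assms(1,3) by (auto dest: subsetD inj_onD[OF inv_inj])
  finally show ?thesis by (simp add: measure_Int_set_pmf measure_pmf_single)
qed

text \<open>The group may be infinite, so sums over it are replaced by sums over a finite window
  \<open>D\<close>. A window containing both \<open>W\<close> and its translate by \<open>g\<close>
  sees all of \<phi> before and after the shift.\<close>

lemma sum_translate:
  fixes \<phi> :: "'a \<Rightarrow> real"
  assumes "finite D" "D \<subseteq> carrier G" "g \<in> carrier G" "W \<subseteq> D" "(\<lambda>x. g \<otimes> x) ` W \<subseteq> D"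
    and "\<And>x. x \<in> carrier G - W \<Longrightarrow> \<phi> x = 0"
  shows "(\<Sum>x\<in>D. \<phi> (inv g \<otimes> x)) = sum \<phi> W"
proof -
  have W: "W \<subseteq> carrier G" using assms by blast
  have "(\<Sum>x\<in>D. \<phi> (inv g \<otimes> x)) = (\<Sum>x\<in>(\<lambda>x. g \<otimes> x) ` W. \<phi> (inv g \<otimes> x))"
  proof (rule sum.mono_neutral_right)
    show "\<forall>i\<in>D - (\<lambda>x. g \<otimes> x) ` W. \<phi> (inv g \<otimes> i) = 0"
    proof
      fix i assume i: "i \<in> D - (\<lambda>x. g \<otimes> x) ` W"
      then have "i = g \<otimes> (inv g \<otimes> i)" "i \<in> carrier G"
        using assms by (auto simp: cancel_inv subset_iff)
      then have "inv g \<otimes> i \<notin> W" using i by auto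
      with \<open>i \<in> carrier G\<close> show "\<phi> (inv g \<otimes> i) = 0" using assms by auto
    qed
  qed (use assms in auto)
  also have "\<dots> = (\<Sum>x\<in>W. \<phi> (inv g \<otimes> (g \<otimes> x)))"
    by (rule sum.reindex_cong[where l = "\<lambda>x. g \<otimes> x"]) (use W assms in \<open>auto simp: inj_on_def subset_iff\<close>)
  also have "\<dots> = sum \<phi> W"
    by (rule sum.cong) (use W assms in \<open>auto simp: cancel_inv subset_iff\<close>)
  finally show ?thesis .
qed

end

section \<open>Symmetric walks and their return probabilities\<close>

locale symmetric_walk = group +
  fixes \<mu> :: "'a pmf"
  assumes finite_support: "finite (set_pmf \<mu>)"
    and support_carrier: "set_pmf \<mu> \<subseteq> carrier G"
    and symmetric: "map_pmf (\<lambda>x. inv x) \<mu> = \<mu>"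
begin

lemma set_walk_carrier: "set_pmf (walk \<mu> k) \<subseteq> carrier G"
  by (induction k) (simp_all add: set_conv_pmf_carrier support_carrier)

lemma finite_set_walk: "finite (set_pmf (walk \<mu> k))"
  by (induction k) (auto simp: set_conv_pmf finite_support)

lemma walk_add: "walk \<mu> (j + k) = conv_pmf (walk \<mu> j) (walk \<mu> k)"
proof (induction j)
  case 0
  have "map_pmf (\<lambda>x. \<one> \<otimes> x) (walk \<mu> k) = map_pmf (\<lambda>x. x) (walk \<mu> k)"
    by (rule map_pmf_cong) (use set_walk_carrier[of k] in auto)
  then show ?case by (simp add: conv_pmf_def bind_return_pmf)
next
  case (Suc j)
  then show ?case
    by (simp add: conv_pmf_assoc support_carrier set_walk_carrier)
qed

lemma walk_1: "walk \<mu> 1 = \<mu>"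
proof -
  have "bind_pmf \<mu> (\<lambda>g. return_pmf (g \<otimes> \<one>)) = bind_pmf \<mu> return_pmf"
    by (rule bind_pmf_cong) (use support_carrier in auto)
  then show ?thesis by (simp add: conv_pmf_def bind_return_pmf')
qed

text \<open>Inversion turns the step added on the left into one added on the right; by
  \<open>walk_add\<close> both give the law of \<open>Suc k\<close> steps.\<close>

lemma walk_symmetric: "map_pmf (\<lambda>x. inv x) (walk \<mu> k) = walk \<mu> k"
proof (induction k)
  case (Suc k)
  have "map_pmf (\<lambda>x. inv x) (walk \<mu> (Suc k)) = conv_pmf (walk \<mu> k) \<mu>"
    using Suc by (simp add: map_inv_conv_pmf support_carrier set_walk_carrier symmetric)
  also have "\<dots> = walk \<mu> (k + 1)" unfolding walk_add walk_1 ..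
  finally show ?case by simp
qed simp

lemma pmf_walk_inv: "x \<in> carrier G \<Longrightarrow> pmf (walk \<mu> k) (inv x) = pmf (walk \<mu> k) x"
  by (rule pmf_inv_symmetric) (simp_all add: walk_symmetric set_walk_carrier)

lemma pmf_walk_add:
  "x \<in> carrier G \<Longrightarrow>
    pmf (walk \<mu> (j + k)) x = (\<Sum>g\<in>set_pmf (walk \<mu> j). pmf (walk \<mu> j) g * pmf (walk \<mu> k) (inv g \<otimes> x))"
  by (simp add: walk_add pmf_conv finite_set_walk set_walk_carrier)

lemma pmf_walk_double:
  "pmf (walk \<mu> (k + k)) \<one> = (\<Sum>g\<in>set_pmf (walk \<mu> k). (pmf (walk \<mu> k) g)\<^sup>2)"
  unfolding pmf_walk_add[OF one_closed] power2_eq_square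
  by (intro sum.cong refl)
     (use set_walk_carrier[of k] in \<open>auto simp: pmf_walk_inv subset_iff\<close>)

lemma sum_pmf_walk_eq:
  assumes "finite D" "set_pmf (walk \<mu> k) \<subseteq> D" "\<phi> 0 = 0"
  shows "(\<Sum>x\<in>D. \<phi> (pmf (walk \<mu> k) x)) = (\<Sum>x\<in>set_pmf (walk \<mu> k). \<phi> (pmf (walk \<mu> k) x))"
  by (rule sum.mono_neutral_right) (use assms in \<open>auto simp: set_pmf_iff\<close>)

text \<open>By symmetry the left side is the correlation of the \<open>k\<close>-step law with its
  translate by \<open>x\<close>. The inequality
  \<open>a * b \<le> (a\<^sup>2 + b\<^sup>2) / 2\<close> bounds it by the mean of two square sums,
  each equal to the return probability by \<open>pmf_walk_double\<close>.\<close>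

lemma pmf_walk_le_return:
  assumes "x \<in> carrier G"
  shows "pmf (walk \<mu> (k + k)) x \<le> pmf (walk \<mu> (k + k)) \<one>"
proof -
  let ?f = "pmf (walk \<mu> k)" and ?S = "set_pmf (walk \<mu> k)"
  have S: "?S \<subseteq> carrier G" "finite ?S" by (fact set_walk_carrier finite_set_walk)+
  define D where "D = ?S \<union> (\<lambda>y. x \<otimes> y) ` ?S"
  have D: "finite D" "D \<subseteq> carrier G" "?S \<subseteq> D" using S assms by (auto simp: D_def)
  have sq: "(\<Sum>g\<in>D. (?f g)\<^sup>2) = pmf (walk \<mu> (k + k)) \<one>"
    unfolding pmf_walk_double
    by (rule sum_pmf_walk_eq[where \<phi> = "\<lambda>t. t\<^sup>2"]) (use D in auto)
  have sq': "(\<Sum>g\<in>D. (?f (inv x \<otimes> g))\<^sup>2) = pmf (walk \<mu> (k + k)) \<one>"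
    unfolding pmf_walk_double
    by (rule sum_translate[where \<phi> = "\<lambda>y. (?f y)\<^sup>2"])
       (use D assms in \<open>auto simp: D_def set_pmf_iff\<close>)
  have "pmf (walk \<mu> (k + k)) x = (\<Sum>g\<in>?S. ?f g * ?f (inv x \<otimes> g))"
    unfolding pmf_walk_add[OF assms]
  proof (intro sum.cong refl)
    fix g assume "g \<in> ?S"
    then have g: "g \<in> carrier G" using S by auto
    then have "inv (inv x \<otimes> g) = inv g \<otimes> x" using assms by (simp add: inv_mult_group)
    then show "?f g * ?f (inv g \<otimes> x) = ?f g * ?f (inv x \<otimes> g)"
      using pmf_walk_inv[of "inv x \<otimes> g" k] g assms by simp
  qed
  also have "\<dots> \<le> (\<Sum>g\<in>?S. ((?f g)\<^sup>2 + (?f (inv x \<otimes> g))\<^sup>2) / 2)"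
  proof (rule sum_mono)
    fix g
    have "0 \<le> (?f g - ?f (inv x \<otimes> g))\<^sup>2" by simp
    then show "?f g * ?f (inv x \<otimes> g) \<le> ((?f g)\<^sup>2 + (?f (inv x \<otimes> g))\<^sup>2) / 2"
      by (simp add: power2_eq_square algebra_simps)
  qed
  also have "\<dots> \<le> (\<Sum>g\<in>D. ((?f g)\<^sup>2 + (?f (inv x \<otimes> g))\<^sup>2) / 2)"
    by (rule sum_mono2) (use D in auto)
  also have "\<dots> = pmf (walk \<mu> (k + k)) \<one>"
    using sq sq' by (simp add: sum.distrib sum_divide_distrib[symmetric])
  finally show ?thesis .
qed

lemma pmf_walk_Suc_le:
  assumes "x \<in> carrier G" and "\<And>y. y \<in> carrier G \<Longrightarrow> pmf (walk \<mu> k) y \<le> b"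
  shows "pmf (walk \<mu> (Suc k)) x \<le> b"
proof -
  have "pmf (walk \<mu> (Suc k)) x = (\<Sum>g\<in>set_pmf \<mu>. pmf \<mu> g * pmf (walk \<mu> k) (inv g \<otimes> x))"
    by (simp add: pmf_conv finite_support support_carrier set_walk_carrier assms)
  also have "\<dots> \<le> (\<Sum>g\<in>set_pmf \<mu>. pmf \<mu> g * b)"
    by (intro sum_mono mult_left_mono assms m_closed inv_closed)
       (use support_carrier assms in auto)
  also have "\<dots> = b"
    by (simp add: sum_distrib_right[symmetric] sum_pmf_eq_1 finite_support)
  finally show ?thesis .
qed

lemma pmf_walk_le_half:
  assumes "x \<in> carrier G"
  shows "pmf (walk \<mu> n) x \<le> pmf (walk \<mu> (n div 2 + n div 2)) \<one>"
proof (cases "even n")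
  case True
  then have "n div 2 + n div 2 = n" by auto
  then show ?thesis using pmf_walk_le_return[OF assms, of "n div 2"] by simp
next
  case False
  then have "Suc (n div 2 + n div 2) = n" by presburger
  moreover have "pmf (walk \<mu> (Suc (n div 2 + n div 2))) x \<le> pmf (walk \<mu> (n div 2 + n div 2)) \<one>"
    by (rule pmf_walk_Suc_le[OF assms pmf_walk_le_return])
  ultimately show ?thesis by (simp only:)
qed

text \<open>After an even number of steps the largest point mass sits at the identity, and averaging
  over two further steps cannot raise the largest point mass.\<close>

lemma return_antimono:
  assumes "j \<le> k"
  shows "pmf (walk \<mu> (k + k)) \<one> \<le> pmf (walk \<mu> (j + j)) \<one>"
  using assms
proof (induction k rule: dec_induct)
  case (step k)
  have "pmf (walk \<mu> (Suc (Suc (k + k)))) \<one> \<le> pmf (walk \<mu> (k + k)) \<one>"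
    by (intro pmf_walk_Suc_le pmf_walk_le_return) auto
  then show ?case using step by simp
qed simp

end

section \<open>Isoperimetry from stabilizers\<close>

context group
begin

text \<open>Translation acts freely, so evaluating the elements of the stabilizer at one fixed point
  of \<open>S\<close> embeds it into \<open>S\<close>.\<close>

lemma stabilizer_subgroup:
  assumes "finite S" "S \<noteq> {}" "S \<subseteq> carrier G"
  defines "H \<equiv> {g \<in> carrier G. (\<lambda>x. g \<otimes> x) ` S = S}"
  shows "subgroup H G" "finite H" "card H \<le> card S"
proof -
  have comp: "(\<lambda>x. g \<otimes> h \<otimes> x) ` S = (\<lambda>x. g \<otimes> x) ` (\<lambda>x. h \<otimes> x) ` S"
    if "g \<in> carrier G" "h \<in> carrier G" for g h
    unfolding image_image by (intro image_cong refl) (use that assms(3) in \<open>auto simp: m_assoc\<close>)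
  have one: "(\<lambda>x. \<one> \<otimes> x) ` S = S"
  proof -
    have "(\<lambda>x. \<one> \<otimes> x) ` S = (\<lambda>x. x) ` S"
      by (intro image_cong refl) (use assms(3) in auto)
    then show ?thesis by simp
  qed
  show "subgroup H G"
  proof (rule subgroupI)
    show "H \<noteq> {}" using one by (auto simp: H_def)
    show "H \<subseteq> carrier G" by (auto simp: H_def)
    show "g \<otimes> h \<in> H" if "g \<in> H" "h \<in> H" for g h
      using that comp[of g h] by (auto simp: H_def)
    show "inv g \<in> H" if "g \<in> H" for g
    proof -
      have g: "g \<in> carrier G" "(\<lambda>x. g \<otimes> x) ` S = S" using that by (auto simp: H_def)
      then have "(\<lambda>x. inv g \<otimes> x) ` S = S" using comp[of "inv g" g] one by simp
      then show ?thesis using g by (auto simp: H_def)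
    qed
  qed
  obtain s where s: "s \<in> S" using assms by auto
  have inj: "inj_on (\<lambda>g. g \<otimes> s) H"
    using s assms(3) by (auto simp: inj_on_def H_def)
  have sub: "(\<lambda>g. g \<otimes> s) ` H \<subseteq> S"
    using s by (auto simp: H_def)
  show "finite H" using inj sub assms(1) by (meson finite_imageD finite_subset)
  show "card H \<le> card S" using card_inj_on_le[OF inj sub assms(1)] .
qed

text \<open>The stabilizer of \<open>S\<close> has at most \<open>card S \<le> N\<close> elements,
  hence mass at most 3/4. Any increment outside it carries some point of \<open>S\<close> out of
  \<open>S\<close> and so contributes at least 1 to the inner sum.\<close>

lemma coarea_indicator:
  assumes \<eta>: "finite (set_pmf \<eta>)" "set_pmf \<eta> \<subseteq> carrier G"
    and esc: "\<And>H. subgroup H G \<Longrightarrow> finite H \<Longrightarrow> card H \<le> N \<Longrightarrow> measure (measure_pmf \<eta>) H \<le> 3 / 4"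
    and D: "finite D" "D \<subseteq> carrier G" "S \<subseteq> D" "\<And>g. g \<in> set_pmf \<eta> \<Longrightarrow> (\<lambda>x. g \<otimes> x) ` S \<subseteq> D"
    and S: "S \<noteq> {}" "card S \<le> N"
  shows "1 / 4 \<le> (\<Sum>g\<in>set_pmf \<eta>. pmf \<eta> g *
           (\<Sum>x\<in>D. \<bar>indicator S (inv g \<otimes> x) - indicator S x\<bar> :: real))"
proof -
  define H where "H = {g \<in> carrier G. (\<lambda>x. g \<otimes> x) ` S = S}"
  have fS: "finite S" and cS: "S \<subseteq> carrier G" using D by (auto intro: finite_subset)
  note H = stabilizer_subgroup[OF fS S(1) cS, folded H_def]
  have moved: "1 \<le> (\<Sum>x\<in>D. \<bar>indicator S (inv g \<otimes> x) - indicator S x\<bar> :: real)"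
    if g: "g \<in> set_pmf \<eta> - H" for g
  proof -
    have gc: "g \<in> carrier G" using g \<eta> by auto
    have "inj_on (\<lambda>x. g \<otimes> x) S" using gc cS by (auto simp: inj_on_def subset_iff)
    then have "card ((\<lambda>x. g \<otimes> x) ` S) = card S" by (rule card_image)
    then have "\<not> (\<lambda>x. g \<otimes> x) ` S \<subseteq> S"
      using card_subset_eq[OF fS] g gc by (auto simp: H_def)
    then obtain s where s: "s \<in> S" "g \<otimes> s \<notin> S" by auto
    have "g \<otimes> s \<in> D" using D(4)[of g] g s by auto
    moreover have "\<bar>indicator S (inv g \<otimes> (g \<otimes> s)) - indicator S (g \<otimes> s)\<bar> = (1::real)"
      using s gc cS by (auto simp: cancel_inv subset_iff)
    ultimately show ?thesis
      using member_le_sum[of "g \<otimes> s" D "\<lambda>x. \<bar>indicator S (inv g \<otimes> x) - indicator S x\<bar> :: real"] D(1)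
      by auto
  qed
  have "1 - 3 / 4 \<le> 1 - measure (measure_pmf \<eta>) H" using esc H S(2) by fastforce
  also have "\<dots> = measure (measure_pmf \<eta>) (- H)"
    by (simp add: measure_pmf.prob_compl[of H \<eta>, simplified] Compl_eq_Diff_UNIV)
  also have "\<dots> = (\<Sum>g\<in>set_pmf \<eta> - H. pmf \<eta> g)"
    using measure_measure_pmf_finite[of "set_pmf \<eta> - H" \<eta>] \<eta>
    by (subst measure_Int_set_pmf[symmetric]) (simp add: Diff_eq Int_commute)
  also have "\<dots> \<le> (\<Sum>g\<in>set_pmf \<eta> - H. pmf \<eta> g *
           (\<Sum>x\<in>D. \<bar>indicator S (inv g \<otimes> x) - indicator S x\<bar> :: real))"
    by (intro sum_mono) (use moved in \<open>auto intro: mult_left_le_one_le simp: mult_le_cancel_left1\<close>)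
  also have "\<dots> \<le> (\<Sum>g\<in>set_pmf \<eta>. pmf \<eta> g *
           (\<Sum>x\<in>D. \<bar>indicator S (inv g \<otimes> x) - indicator S x\<bar> :: real))"
    by (rule sum_mono2) (auto intro!: \<eta> mult_nonneg_nonneg sum_nonneg)
  finally show ?thesis by simp
qed

text \<open>Layer-cake decomposition: peel off the smallest positive value of \<open>\<phi>\<close> times the indicator of its
  support.\<close>

lemma coarea:
  fixes \<phi> :: "'a \<Rightarrow> real"
  assumes \<eta>: "finite (set_pmf \<eta>)" "set_pmf \<eta> \<subseteq> carrier G"
    and esc: "\<And>H. subgroup H G \<Longrightarrow> finite H \<Longrightarrow> card H \<le> N \<Longrightarrow> measure (measure_pmf \<eta>) H \<le> 3 / 4"
    and D: "finite D" "D \<subseteq> carrier G" "W \<subseteq> D" "\<And>g. g \<in> set_pmf \<eta> \<Longrightarrow> (\<lambda>x. g \<otimes> x) ` W \<subseteq> D"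
    and W: "card W \<le> N"
    and \<phi>: "\<And>x. \<phi> x \<ge> 0" "\<And>x. x \<notin> W \<Longrightarrow> \<phi> x = 0"
  shows "\<phi> y / 4 \<le> (\<Sum>g\<in>set_pmf \<eta>. pmf \<eta> g * (\<Sum>x\<in>D. \<bar>\<phi> (inv g \<otimes> x) - \<phi> x\<bar>))"
  using D(3,4) W \<phi>
proof (induction "card W" arbitrary: W \<phi> rule: less_induct)
  case less
  let ?F = "\<lambda>\<psi>. \<Sum>g\<in>set_pmf \<eta>. pmf \<eta> g * (\<Sum>x\<in>D. \<bar>\<psi> (inv g \<otimes> x) - \<psi> x\<bar> :: real)"
  have F_nonneg: "?F \<phi> \<ge> 0" by (intro sum_nonneg mult_nonneg_nonneg) auto
  define S where "S = {x \<in> W. \<phi> x > 0}"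
  have finW: "finite W" using less.prems D by (auto intro: finite_subset)
  show ?case
  proof (cases "y \<in> S")
    case False
    then have "\<phi> y = 0" using less.prems(4,5)[of y] by (force simp: S_def)
    then show ?thesis using F_nonneg by simp
  next
    case True
    define m where "m = Min (\<phi> ` S)"
    have finS: "finite S" using finW by (simp add: S_def)
    have "m \<in> \<phi> ` S" unfolding m_def by (rule Min_in) (use finS True in auto)
    then obtain z where z: "z \<in> S" "\<phi> z = m" by auto
    have m: "m > 0" "\<And>x. x \<in> S \<Longrightarrow> m \<le> \<phi> x"
      using z finS by (auto simp: S_def m_def)
    have \<phi>S: "\<phi> x = 0" if "x \<notin> S" for x
      using that less.prems(4,5)[of x] by (force simp: S_def)
    define \<psi> where "\<psi> = (\<lambda>x. \<phi> x - m * indicator S x)"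
    have cS: "card S \<le> card W" using finW by (auto simp: S_def intro: card_mono)
    \<comment> \<open>Since \<open>\<psi> z = 0\<close>, peeling off one layer strictly shrinks the
      support, which drives the induction on \<open>card W\<close>.\<close>
    have "card (S - {z}) < card W"
      using z finS cS by (metis card_Diff1_less less_le_trans)
    then have IH: "\<psi> y / 4 \<le> ?F \<psi>"
    proof (rule less.hyps)
      show "S - {z} \<subseteq> D" using less.prems by (auto simp: S_def)
      show "(\<lambda>x. g \<otimes> x) ` (S - {z}) \<subseteq> D" if "g \<in> set_pmf \<eta>" for g
        using less.prems(2)[OF that] by (auto simp: S_def)
      show "card (S - {z}) \<le> N" 
        using cS less.prems(3) card_Diff1_le[of S z] by linarith
      show "\<psi> x \<ge> 0" for x
        using m \<phi>S[of x] by (cases "x \<in> S") (auto simp: \<psi>_def)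
      show "\<psi> x = 0" if "x \<notin> S - {z}" for x
        using that z \<phi>S[of x] by (cases "x \<in> S") (auto simp: \<psi>_def)
    qed
    have ind: "1 / 4 \<le> ?F (indicator S)"
    proof (rule coarea_indicator[OF \<eta>, where N = N])
      show "S \<subseteq> D" using less.prems by (auto simp: S_def)
      show "(\<lambda>x. g \<otimes> x) ` S \<subseteq> D" if "g \<in> set_pmf \<eta>" for g
        using less.prems(2)[OF that] by (auto simp: S_def)
      show "card S \<le> N" using cS less.prems(3) by linarith
      show "S \<noteq> {}" using True by auto
    qed (use esc D in auto)
    \<comment> \<open>On \<open>S\<close> the value of \<phi> is at least \<open>m\<close> and off
      \<open>S\<close> it is 0, so \<psi> and the indicator never change in opposite directions and
      their absolute differences add up exactly.\<close>
    have split: "\<bar>\<phi> a - \<phi> b\<bar> = \<bar>\<psi> a - \<psi> b\<bar> + m * \<bar>indicator S a - indicator S b\<bar>" for a b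
      using m(1) m(2)[of a] m(2)[of b] \<phi>S[of a] \<phi>S[of b]
      by (cases "a \<in> S"; cases "b \<in> S") (auto simp: \<psi>_def)
    have "?F \<phi> = ?F \<psi> + m * ?F (indicator S)"
      unfolding split by (simp add: sum.distrib sum_distrib_left algebra_simps)
    moreover have "m * (1 / 4) \<le> m * ?F (indicator S)"
      using ind m(1) by (intro mult_left_mono) auto
    ultimately show ?thesis using IH True by (simp add: \<psi>_def)
  qed
qed

text \<open>Nash's argument: cutting \<open>f\<close> off at height \<open>u / 2\<close> leaves a
  function \<open>h\<close> with support small enough for \<open>coarea\<close>. Applying that to
  the square of \<open>h\<close> and using Cauchy-Schwarz compares the maximum of \<open>h\<close>
  with the energy of \<open>f\<close>.\<close>

lemma nash_finite_support:
  fixes f :: "'a \<Rightarrow> real" and u :: real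
  assumes \<eta>: "finite (set_pmf \<eta>)" "set_pmf \<eta> \<subseteq> carrier G"
    and esc: "\<And>H. subgroup H G \<Longrightarrow> finite H \<Longrightarrow> card H \<le> N \<Longrightarrow> measure (measure_pmf \<eta>) H \<le> 3 / 4"
    and D: "finite D" "D \<subseteq> carrier G" "Z \<subseteq> D" "\<And>g. g \<in> set_pmf \<eta> \<Longrightarrow> (\<lambda>x. g \<otimes> x) ` Z \<subseteq> D"
    and f: "\<And>x. f x \<ge> 0" "\<And>x. x \<notin> Z \<Longrightarrow> f x = 0" "sum f Z = 1"
    and u: "(\<Sum>x\<in>Z. (f x)\<^sup>2) = u" "2 / u \<le> real N"
    and shift: "\<And>g. g \<in> set_pmf \<eta> \<Longrightarrow> (\<Sum>x\<in>D. (f (inv g \<otimes> x))\<^sup>2) = u"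
  shows "u ^ 3 / 1024 \<le> (\<Sum>g\<in>set_pmf \<eta>. pmf \<eta> g * (\<Sum>x\<in>D. (f (inv g \<otimes> x) - f x)\<^sup>2))"
proof -
  have finZ: "finite Z" using D by (auto intro: finite_subset)
  have sumD: "(\<Sum>x\<in>D. (f x)\<^sup>2) = u"
    unfolding u(1)[symmetric] by (rule sum.mono_neutral_right) (use D f in auto)
  have "Z \<noteq> {}" using f(3) by auto
  define M where "M = Max (f ` Z)"
  have "M \<in> f ` Z" unfolding M_def by (rule Max_in) (use finZ \<open>Z \<noteq> {}\<close> in auto)
  then obtain y where y: "y \<in> Z" "f y = M" by auto
  have leM: "f x \<le> M" if "x \<in> Z" for x using that finZ by (auto simp: M_def)
  \<comment> \<open>As \<open>f\<close> has total mass 1, its square sum is at most its maximum, so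
    a point \<open>y\<close> survives the cut with height at least \<open>u / 2\<close>.\<close>
  have "u = (\<Sum>x\<in>Z. f x * f x)" using u by (simp add: power2_eq_square)
  also have "\<dots> \<le> (\<Sum>x\<in>Z. M * f x)" by (intro sum_mono mult_right_mono leM f)
  also have "\<dots> = M" using f(3) by (simp add: sum_distrib_left[symmetric])
  finally have uM: "u \<le> M" .
  have "\<exists>x\<in>Z. f x \<noteq> 0" using f(3) by (metis sum.neutral zero_neq_one)
  then have u_pos: "u > 0"
    unfolding u(1)[symmetric] using finZ by (auto intro!: sum_pos2)
  \<comment> \<open>Markov's inequality: total mass 1 leaves at most \<open>2 / u \<le> N\<close>
    points where \<open>f\<close> exceeds \<open>u / 2\<close>.\<close>
  define W where "W = {x \<in> Z. f x > u / 2}"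
  have finW: "finite W" using finZ by (simp add: W_def)
  have "real (card W) * (u / 2) = (\<Sum>x\<in>W. u / 2)" by simp
  also have "\<dots> \<le> sum f W" by (rule sum_mono) (auto simp: W_def)
  also have "\<dots> \<le> sum f Z" by (rule sum_mono2) (use finZ f in \<open>auto simp: W_def\<close>)
  finally have "real (card W) \<le> 2 / u" using f(3) u_pos by (simp add: field_simps)
  then have cW: "card W \<le> N" using u(2) by linarith
  define h where "h = (\<lambda>x. max (f x - u / 2) 0)"
  have h0: "h x \<ge> 0" and hf: "h x \<le> f x" for x using f(1)[of x] u_pos by (auto simp: h_def)
  have hW: "h x = 0" if "x \<notin> W" for x
    using that f(2)[of x] u_pos by (cases "x \<in> Z") (auto simp: h_def W_def)
  have hd: "(h a - h b)\<^sup>2 \<le> (f a - f b)\<^sup>2" for a b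
    by (rule abs_le_square_iff[THEN iffD1]) (auto simp: h_def max_def)
  have hs: "(h a + h b)\<^sup>2 \<le> 2 * (f a)\<^sup>2 + 2 * (f b)\<^sup>2" for a b
  proof -
    have "(h a + h b)\<^sup>2 \<le> (f a + f b)\<^sup>2" by (intro power_mono add_mono hf add_nonneg_nonneg h0)
    also have "\<dots> = 2 * (f a)\<^sup>2 + 2 * (f b)\<^sup>2 - (f a - f b)\<^sup>2"
      by (simp add: power2_eq_square algebra_simps)
    finally show ?thesis using zero_le_power2[of "f a - f b"] by linarith
  qed
  let ?I = "set_pmf \<eta> \<times> D"
  let ?E = "\<Sum>g\<in>set_pmf \<eta>. pmf \<eta> g * (\<Sum>x\<in>D. (f (inv g \<otimes> x) - f x)\<^sup>2)"
  let ?a = "\<lambda>(g, x). sqrt (pmf \<eta> g) * \<bar>h (inv g \<otimes> x) - h x\<bar>"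
  let ?b = "\<lambda>(g, x). sqrt (pmf \<eta> g) * (h (inv g \<otimes> x) + h x)"
  \<comment> \<open>The difference of squares factors into difference times sum. The weight
    \<open>pmf \<eta> g\<close> is split into two square roots, giving the factors \<open>?a\<close>
    and \<open>?b\<close> for Cauchy-Schwarz over pairs.\<close>
  have "(h y)\<^sup>2 / 4 \<le> (\<Sum>g\<in>set_pmf \<eta>. pmf \<eta> g * (\<Sum>x\<in>D. \<bar>(h (inv g \<otimes> x))\<^sup>2 - (h x)\<^sup>2\<bar>))"
  proof (rule coarea[OF \<eta> esc D(1,2) _ _ cW])
    have "W \<subseteq> Z" by (auto simp: W_def)
    then show "W \<subseteq> D" "\<And>g. g \<in> set_pmf \<eta> \<Longrightarrow> (\<lambda>x. g \<otimes> x) ` W \<subseteq> D"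
      using D(3,4) by blast+
  qed (use hW in auto)
  also have "\<dots> = (\<Sum>(g, x)\<in>?I. pmf \<eta> g * \<bar>(h (inv g \<otimes> x))\<^sup>2 - (h x)\<^sup>2\<bar>)"
    by (simp add: sum.cartesian_product sum_distrib_left)
  also have "\<dots> = (\<Sum>p\<in>?I. ?a p * ?b p)"
  proof (intro sum.cong refl, clarify)
    fix g x
    have factor: "\<bar>(h (inv g \<otimes> x))\<^sup>2 - (h x)\<^sup>2\<bar> = \<bar>h (inv g \<otimes> x) - h x\<bar> * (h (inv g \<otimes> x) + h x)"
      using h0[of "inv g \<otimes> x"] h0[of x] by (simp add: power2_eq_square square_diff_square_factored abs_mult)
    have root: "pmf \<eta> g = sqrt (pmf \<eta> g) * sqrt (pmf \<eta> g)" by simp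
    show "pmf \<eta> g * \<bar>(h (inv g \<otimes> x))\<^sup>2 - (h x)\<^sup>2\<bar>
      = sqrt (pmf \<eta> g) * \<bar>h (inv g \<otimes> x) - h x\<bar> * (sqrt (pmf \<eta> g) * (h (inv g \<otimes> x) + h x))"
      unfolding factor by (subst root) (simp only: mult_ac)
  qed
  finally have "((h y)\<^sup>2 / 4)\<^sup>2 \<le> (\<Sum>p\<in>?I. ?a p * ?b p)\<^sup>2" by (intro power_mono) auto
  also have "\<dots> \<le> (\<Sum>p\<in>?I. (?a p)\<^sup>2) * (\<Sum>p\<in>?I. (?b p)\<^sup>2)"
    by (rule Cauchy_Schwarz_ineq_sum)
  \<comment> \<open>Truncation does not increase differences, which yields the energy
    \<open>?E\<close>. The sum factor is at most twice the square sums of \<open>f\<close> and of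
    its translate, each equal to \<open>u\<close>.\<close>
  also have "\<dots> \<le> ?E * (4 * u)"
  proof (rule mult_mono)
    have "(\<Sum>p\<in>?I. (?a p)\<^sup>2) \<le> (\<Sum>(g, x)\<in>?I. pmf \<eta> g * (f (inv g \<otimes> x) - f x)\<^sup>2)"
      by (intro sum_mono) (auto simp: power_mult_distrib intro!: mult_left_mono hd)
    also have "\<dots> = ?E" by (simp add: sum.cartesian_product sum_distrib_left)
    finally show "(\<Sum>p\<in>?I. (?a p)\<^sup>2) \<le> ?E" .
    have "(\<Sum>p\<in>?I. (?b p)\<^sup>2)
        \<le> (\<Sum>(g, x)\<in>?I. pmf \<eta> g * (2 * (f (inv g \<otimes> x))\<^sup>2 + 2 * (f x)\<^sup>2))"
      by (intro sum_mono) (auto simp: power_mult_distrib intro!: mult_left_mono hs)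
    also have "\<dots> = (\<Sum>g\<in>set_pmf \<eta>. pmf \<eta> g * (2 * (\<Sum>x\<in>D. (f (inv g \<otimes> x))\<^sup>2) + 2 * (\<Sum>x\<in>D. (f x)\<^sup>2)))"
      by (simp add: sum.cartesian_product[symmetric] sum_distrib_left sum.distrib algebra_simps)
    also have "\<dots> = (\<Sum>g\<in>set_pmf \<eta>. pmf \<eta> g * (4 * u))"
      by (intro sum.cong refl) (simp add: shift sumD)
    also have "\<dots> = 4 * u"
      by (simp add: sum_distrib_right[symmetric] sum_pmf_eq_1 \<eta>)
    finally show "(\<Sum>p\<in>?I. (?b p)\<^sup>2) \<le> 4 * u" .
  qed (auto intro!: sum_nonneg mult_nonneg_nonneg)
  finally have main: "((h y)\<^sup>2 / 4)\<^sup>2 \<le> ?E * (4 * u)" .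
  \<comment> \<open>The left side of \<open>main\<close> is then at least
    \<open>u ^ 4 / 256\<close>; dividing by \<open>4 * u\<close> produces the constant 1024.\<close>
  have "u / 2 \<le> h y" using y(2) uM unfolding h_def by (intro max.coboundedI1) linarith
  then have "((u / 2)\<^sup>2 / 4)\<^sup>2 \<le> ((h y)\<^sup>2 / 4)\<^sup>2"
    using u_pos by (intro power_mono divide_right_mono) auto
  with main have "(u ^ 3 / 1024) * (4 * u) \<le> ?E * (4 * u)"
    by (simp add: power2_eq_square power3_eq_cube)
  then show ?thesis using u_pos by simp
qed

end

section \<open>Decay of return probabilities and escape from cosets\<close>

context group
begin

text \<open>Increments carrying the left coset \<open>xH\<close> to \<open>yH\<close> form a left
  coset not of \<open>H\<close> but of its conjugate by \<open>x\<close>, which has to obey the same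
  order bound.\<close>

lemma conjugate_subgroup:
  assumes "subgroup H G" "x \<in> carrier G" "finite H"
  defines "K \<equiv> (\<lambda>h. x \<otimes> h \<otimes> inv x) ` H"
  shows "subgroup K G" "finite K" "card K \<le> card H"
proof -
  have H: "H \<subseteq> carrier G" using assms(1) by (rule subgroup.subset)
  show "subgroup K G"
  proof (rule subgroupI)
    show "K \<noteq> {}" using subgroup.one_closed[OF assms(1)] by (auto simp: K_def)
    show "K \<subseteq> carrier G" using H assms(2) by (auto simp: K_def)
    show "inv a \<in> K" if "a \<in> K" for a
    proof -
      from that obtain h where h: "h \<in> H" "a = x \<otimes> h \<otimes> inv x" by (auto simp: K_def)
      then have "inv a = x \<otimes> inv h \<otimes> inv x"
        using H assms(2) by (simp add: inv_mult_group m_assoc subset_iff)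
      then show ?thesis using subgroup.m_inv_closed[OF assms(1) h(1)] by (auto simp: K_def)
    qed
    show "a \<otimes> b \<in> K" if ab: "a \<in> K" "b \<in> K" for a b
    proof -
      from ab obtain h k where h: "h \<in> H" "a = x \<otimes> h \<otimes> inv x" "k \<in> H" "b = x \<otimes> k \<otimes> inv x"
        by (auto simp: K_def)
      then have "a \<otimes> b = x \<otimes> (h \<otimes> k) \<otimes> inv x"
        using H assms(2) by (simp add: m_assoc subset_iff cancel_inv)
      then show ?thesis using subgroup.m_closed[OF assms(1) h(1,3)] by (auto simp: K_def)
    qed
  qed
  show "finite K" "card K \<le> card H" using assms(3) by (auto simp: K_def card_image_le)
qed

end

context symmetric_walk
begin

text \<open>With \<eta> the law of \<open>k + k\<close> steps, expanding the square in the Nash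
  inequality gives twice the drop of the return probability: both square terms equal the old one and
  the cross term averages to the new one. The factor 2 turns 1024 into 2048.\<close>

lemma return_decay:
  assumes esc: "\<And>H. subgroup H G \<Longrightarrow> finite H \<Longrightarrow> card H \<le> N \<Longrightarrow>
      measure (measure_pmf (walk \<mu> (k + k))) H \<le> 3 / 4"
    and u: "2 / pmf (walk \<mu> (m + m)) \<one> \<le> real N"
  shows "pmf (walk \<mu> (m + m)) \<one> ^ 3 / 2048
      \<le> pmf (walk \<mu> (m + m)) \<one> - pmf (walk \<mu> ((m + k) + (m + k))) \<one>"
proof -
  let ?f = "pmf (walk \<mu> m)" and ?Z = "set_pmf (walk \<mu> m)" and ?\<eta> = "walk \<mu> (k + k)"
  define D where "D = ?Z \<union> (\<Union>g\<in>set_pmf ?\<eta>. (\<lambda>x. g \<otimes> x) ` ?Z)"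
  have Z: "?Z \<subseteq> carrier G" "finite ?Z" and \<eta>: "finite (set_pmf ?\<eta>)" "set_pmf ?\<eta> \<subseteq> carrier G"
    by (fact set_walk_carrier finite_set_walk)+
  have D: "finite D" "D \<subseteq> carrier G" "?Z \<subseteq> D" "\<And>g. g \<in> set_pmf ?\<eta> \<Longrightarrow> (\<lambda>x. g \<otimes> x) ` ?Z \<subseteq> D"
    using Z \<eta> by (auto simp: D_def)
  have shift: "(\<Sum>x\<in>D. (?f (inv g \<otimes> x))\<^sup>2) = pmf (walk \<mu> (m + m)) \<one>" if "g \<in> set_pmf ?\<eta>" for g
    unfolding pmf_walk_double
    by (rule sum_translate[where \<phi> = "\<lambda>y. (?f y)\<^sup>2"])
       (use D(1-3) D(4)[OF that] \<eta> that in \<open>auto simp: set_pmf_iff\<close>)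
  have sumD: "(\<Sum>x\<in>D. (?f x)\<^sup>2) = pmf (walk \<mu> (m + m)) \<one>"
    unfolding pmf_walk_double
    by (rule sum_pmf_walk_eq[where \<phi> = "\<lambda>t. t\<^sup>2"]) (use D in auto)
  \<comment> \<open>Averaging the translates of the \<open>m\<close>-step law over \<eta> gives the
    law after \<open>(k + k) + m\<close> steps; pairing it with another \<open>m\<close> steps gives
    a return probability.\<close>
  have cross: "(\<Sum>g\<in>set_pmf ?\<eta>. pmf ?\<eta> g * (\<Sum>x\<in>D. ?f x * ?f (inv g \<otimes> x)))
      = pmf (walk \<mu> ((m + k) + (m + k))) \<one>"
  proof -
    have "(\<Sum>g\<in>set_pmf ?\<eta>. pmf ?\<eta> g * (\<Sum>x\<in>D. ?f x * ?f (inv g \<otimes> x)))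
        = (\<Sum>g\<in>set_pmf ?\<eta>. pmf ?\<eta> g * (\<Sum>x\<in>?Z. ?f x * ?f (inv g \<otimes> x)))"
      by (intro sum.cong refl arg_cong2[where f = "(*)"] sum.mono_neutral_right)
         (use D in \<open>auto simp: set_pmf_iff\<close>)
    also have "\<dots> = (\<Sum>x\<in>?Z. ?f x * (\<Sum>g\<in>set_pmf ?\<eta>. pmf ?\<eta> g * ?f (inv g \<otimes> x)))"
      unfolding sum_distrib_left by (subst sum.swap) (simp add: ac_simps)
    also have "\<dots> = (\<Sum>x\<in>?Z. ?f x * pmf (walk \<mu> ((k + k) + m)) (inv x \<otimes> \<one>))"
    proof (intro sum.cong refl)
      fix x assume "x \<in> ?Z"
      then have x: "x \<in> carrier G" using Z by auto
      then show "?f x * (\<Sum>g\<in>set_pmf ?\<eta>. pmf ?\<eta> g * ?f (inv g \<otimes> x))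
          = ?f x * pmf (walk \<mu> ((k + k) + m)) (inv x \<otimes> \<one>)"
        using pmf_walk_inv[OF x, of "(k + k) + m"] pmf_walk_add[OF x, of "k + k" m] by simp
    qed
    also have "\<dots> = pmf (walk \<mu> (m + ((k + k) + m))) \<one>"
      using pmf_walk_add[OF one_closed, of m "(k + k) + m"] by simp
    also have "m + ((k + k) + m) = (m + k) + (m + k)" by simp
    finally show ?thesis .
  qed
  have "pmf (walk \<mu> (m + m)) \<one> ^ 3 / 1024
      \<le> (\<Sum>g\<in>set_pmf ?\<eta>. pmf ?\<eta> g * (\<Sum>x\<in>D. (?f (inv g \<otimes> x) - ?f x)\<^sup>2))"
    by (rule nash_finite_support[OF \<eta> esc D])
       (use u shift Z in \<open>auto simp: pmf_walk_double[symmetric] sum_pmf_eq_1 set_pmf_iff\<close>)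
  also have "\<dots> = (\<Sum>g\<in>set_pmf ?\<eta>. pmf ?\<eta> g * (2 * pmf (walk \<mu> (m + m)) \<one>
      - 2 * (\<Sum>x\<in>D. ?f x * ?f (inv g \<otimes> x))))"
  proof (intro sum.cong refl)
    fix g assume g: "g \<in> set_pmf ?\<eta>"
    have "(\<Sum>x\<in>D. (?f (inv g \<otimes> x) - ?f x)\<^sup>2)
        = (\<Sum>x\<in>D. (?f (inv g \<otimes> x))\<^sup>2) + (\<Sum>x\<in>D. (?f x)\<^sup>2) - 2 * (\<Sum>x\<in>D. ?f x * ?f (inv g \<otimes> x))"
      by (simp add: power2_diff sum.distrib sum_subtractf sum_distrib_left ac_simps)
    then show "pmf ?\<eta> g * (\<Sum>x\<in>D. (?f (inv g \<otimes> x) - ?f x)\<^sup>2) = pmf ?\<eta> g *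
      (2 * pmf (walk \<mu> (m + m)) \<one> - 2 * (\<Sum>x\<in>D. ?f x * ?f (inv g \<otimes> x)))"
      by (simp add: shift[OF g] sumD)
  qed
  also have "\<dots> = (\<Sum>g\<in>set_pmf ?\<eta>. pmf ?\<eta> g) * (2 * pmf (walk \<mu> (m + m)) \<one>)
      - 2 * (\<Sum>g\<in>set_pmf ?\<eta>. pmf ?\<eta> g * (\<Sum>x\<in>D. ?f x * ?f (inv g \<otimes> x)))"
    by (simp add: right_diff_distrib sum_subtractf sum_distrib_right sum_distrib_left mult_ac)
  also have "\<dots> = 2 * (pmf (walk \<mu> (m + m)) \<one> - pmf (walk \<mu> ((m + k) + (m + k))) \<one>)"
    unfolding cross by (simp add: sum_pmf_eq_1 \<eta>)
  finally show ?thesis by simp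
qed

text \<open>If a coset \<open>xH\<close> has mass \<open>s > 3/4\<close> after \<open>j\<close> steps and \<open>t\<close> is the probability that the next
  increment maps it to \<open>yH\<close>, then the mass of \<open>yH\<close> is at most \<open>s t + (1 - s) (1 - t)\<close>, and \<open>t \<le> 1 - p\<close>.\<close>

lemma coset_escape:
  assumes esc: "\<And>H x. subgroup H G \<Longrightarrow> finite H \<Longrightarrow> card H \<le> N \<Longrightarrow> x \<in> carrier G \<Longrightarrow>
      measure (measure_pmf \<mu>) ((\<lambda>h. x \<otimes> h) ` H) \<le> 1 - p"
    and p: "0 \<le> p"
    and H: "subgroup H G" "finite H" "card H \<le> N"
    and y: "y \<in> carrier G"
  shows "measure (measure_pmf (walk \<mu> j)) ((\<lambda>h. y \<otimes> h) ` H) \<le> max (3 / 4) (1 - real j * p / 2)"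
  using y
proof (induction j arbitrary: y)
  case 0
  then show ?case by simp
next
  case (Suc j)
  let ?C = "\<lambda>x. (\<lambda>h. x \<otimes> h) ` H" and ?b = "max (3 / 4) (1 - real (Suc j) * p / 2)"
  have Hc: "H \<subseteq> carrier G" using H(1) by (rule subgroup.subset)
  have coset: "(\<lambda>z. g \<otimes> z) -` ?C y \<inter> set_pmf (walk \<mu> j) = ?C (inv g \<otimes> y) \<inter> set_pmf (walk \<mu> j)"
    if g: "g \<in> carrier G" for g
  proof -
    have "g \<otimes> z \<in> ?C y \<longleftrightarrow> z \<in> ?C (inv g \<otimes> y)" if z: "z \<in> carrier G" for z
    proof -
      have "g \<otimes> z = y \<otimes> h \<longleftrightarrow> z = inv g \<otimes> y \<otimes> h" if "h \<in> H" for h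
      proof -
        have "h \<in> carrier G" using that Hc by auto
        then show ?thesis
          using g z Suc.prems by (metis inv_closed m_assoc m_closed cancel_inv)
      qed
      then show ?thesis by auto
    qed
    then show ?thesis using set_walk_carrier[of j] by blast
  qed
  have step: "measure (walk \<mu> (Suc j)) (?C y)
      = (\<Sum>g\<in>set_pmf \<mu>. pmf \<mu> g * measure (walk \<mu> j) (?C (inv g \<otimes> y)))"
    unfolding walk.simps measure_conv_pmf[OF finite_support]
  proof (intro sum.cong refl arg_cong2[where f = "(*)"])
    fix g assume "g \<in> set_pmf \<mu>"
    then have "g \<in> carrier G" using support_carrier by auto
    from coset[OF this] show "measure (walk \<mu> j) ((\<lambda>z. g \<otimes> z) -` ?C y)
        = measure (walk \<mu> j) (?C (inv g \<otimes> y))"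
      by (metis measure_Int_set_pmf)
  qed
  show ?case
  \<comment> \<open>If every coset of \<open>H\<close> has mass at most 3/4, averaging over the next
    increment preserves this. Otherwise a heavy coset \<open>xH\<close> exists and must
    leak.\<close>
  proof (cases "\<exists>x\<in>carrier G. measure (walk \<mu> j) (?C x) > 3 / 4")
    case False
    then have "measure (walk \<mu> (Suc j)) (?C y) \<le> (\<Sum>g\<in>set_pmf \<mu>. pmf \<mu> g * (3 / 4))"
      unfolding step using support_carrier Suc.prems
      by (intro sum_mono mult_left_mono) (auto simp: not_less)
    also have "\<dots> = 3 / 4" by (simp only: sum_distrib_right[symmetric] sum_pmf_eq_1[OF finite_support order_refl])
    finally show ?thesis by simp
  next
    case True
    then obtain x where x: "x \<in> carrier G" "measure (walk \<mu> j) (?C x) > 3 / 4" by auto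
    define s where "s = measure (walk \<mu> j) (?C x)"
    define T where "T = {g \<in> carrier G. inv g \<otimes> y \<in> ?C x}"
    define t where "t = measure \<mu> T"
    have s: "3 / 4 < s" "s \<le> max (3 / 4) (1 - real j * p / 2)" "s \<le> 1"
      using x Suc.IH[OF x(1)] by (auto simp: s_def)
    \<comment> \<open>An element of \<open>T\<close> has the form
      \<open>y \<otimes> inv h \<otimes> inv x\<close> with \<open>h \<in> H\<close>, so
      \<open>T\<close> lies in a left coset of the conjugate \<open>?K\<close>, to which
      \<open>esc\<close> applies.\<close>
    have "t \<le> 1 - p"
    proof -
      let ?K = "(\<lambda>h. x \<otimes> h \<otimes> inv x) ` H"
      note K = conjugate_subgroup[OF H(1) x(1) H(2)]
      have "T \<subseteq> (\<lambda>h. (y \<otimes> inv x) \<otimes> h) ` ?K"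
      proof
        fix g assume "g \<in> T"
        then obtain h where g: "g \<in> carrier G" and h: "h \<in> H" "inv g \<otimes> y = x \<otimes> h"
          by (auto simp: T_def)
        have hc: "h \<in> carrier G" using h Hc by auto
        have "inv g = x \<otimes> h \<otimes> inv y"
          using g h hc x(1) Suc.prems by (metis inv_closed inv_solve_right' m_closed)
        then have "g = inv (x \<otimes> h \<otimes> inv y)" using g by (metis inv_inv)
        also have "\<dots> = (y \<otimes> inv x) \<otimes> (x \<otimes> inv h \<otimes> inv x)"
          using x(1) hc Suc.prems by (simp add: inv_mult_group m_assoc cancel_inv)
        finally show "g \<in> (\<lambda>h. (y \<otimes> inv x) \<otimes> h) ` ?K"
          using subgroup.m_inv_closed[OF H(1) h(1)] by auto
      qed
      then have "t \<le> measure \<mu> ((\<lambda>h. (y \<otimes> inv x) \<otimes> h) ` ?K)"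
        unfolding t_def by (intro measure_pmf.finite_measure_mono) auto
      also have "\<dots> \<le> 1 - p"
        using K H(3) x(1) Suc.prems by (intro esc) auto
      finally show ?thesis .
    qed
    \<comment> \<open>Left cosets coincide or are disjoint: for \<open>g\<close> outside
      \<open>T\<close> the coset of \<open>inv g \<otimes> y\<close> misses \<open>?C x\<close> and
      gets at most the remaining mass \<open>1 - s\<close>.\<close>
    have bound: "measure (walk \<mu> j) (?C (inv g \<otimes> y)) \<le> (if g \<in> T then s else 1 - s)"
      if "g \<in> set_pmf \<mu>" for g
    proof -
      have g: "g \<in> carrier G" using that support_carrier by auto
      show ?thesis
      proof (cases "g \<in> T")
        case True
        then obtain h where h: "h \<in> H" "inv g \<otimes> y = x \<otimes> h" by (auto simp: T_def)
        have "?C (inv g \<otimes> y) \<subseteq> ?C x"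
        proof (clarify)
          fix k assume k: "k \<in> H"
          have "inv g \<otimes> y \<otimes> k = x \<otimes> (h \<otimes> k)"
            using h k Hc x(1) by (simp add: m_assoc subset_iff)
          then show "inv g \<otimes> y \<otimes> k \<in> ?C x"
            using subgroup.m_closed[OF H(1) h(1) k] by auto
        qed
        then show ?thesis unfolding s_def using True
          by (auto intro!: measure_pmf.finite_measure_mono)
      next
        case False
        have "?C (inv g \<otimes> y) \<inter> ?C x = {}"
        proof (rule ccontr)
          assume "\<not> ?thesis"
          then obtain h k where hk: "h \<in> H" "k \<in> H" "inv g \<otimes> y \<otimes> h = x \<otimes> k" by auto
          then have hkc: "h \<in> carrier G" "k \<in> carrier G" using Hc by auto
          have "inv g \<otimes> y = inv g \<otimes> y \<otimes> h \<otimes> inv h"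
            using hkc g Suc.prems by (simp add: m_assoc)
          also have "\<dots> = x \<otimes> (k \<otimes> inv h)"
            unfolding hk(3) using hkc x(1) by (simp add: m_assoc)
          finally have "inv g \<otimes> y \<in> ?C x"
            using subgroup.m_closed[OF H(1) hk(2) subgroup.m_inv_closed[OF H(1) hk(1)]] by auto
          with False g show False by (auto simp: T_def)
        qed
        then have "measure (walk \<mu> j) (?C (inv g \<otimes> y)) \<le> measure (walk \<mu> j) (- ?C x)"
          by (intro measure_pmf.finite_measure_mono) auto
        also have "\<dots> = 1 - s"
          unfolding s_def using measure_pmf.prob_compl[of "?C x" "walk \<mu> j"] by (simp add: Compl_eq_Diff_UNIV)
        finally show ?thesis using False by simp
      qed
    qed
    have "measure (walk \<mu> (Suc j)) (?C y) \<le> (\<Sum>g\<in>set_pmf \<mu>. pmf \<mu> g * (if g \<in> T then s else 1 - s))"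
      unfolding step by (intro sum_mono mult_left_mono bound) auto
    also have "\<dots> = (\<Sum>g\<in>set_pmf \<mu>. pmf \<mu> g * (1 - s) + (2 * s - 1) * (if g \<in> T then pmf \<mu> g else 0))"
      by (intro sum.cong refl) (auto simp: algebra_simps)
    also have "\<dots> = (1 - s) + (2 * s - 1) * (\<Sum>g\<in>set_pmf \<mu>. if g \<in> T then pmf \<mu> g else 0)"
      by (simp only: sum.distrib sum_distrib_right[symmetric] sum_distrib_left[symmetric]
            sum_pmf_eq_1[OF finite_support order_refl] mult_1)
    also have "(\<Sum>g\<in>set_pmf \<mu>. if g \<in> T then pmf \<mu> g else 0) = t"
      unfolding t_def
      using measure_measure_pmf_finite[of "set_pmf \<mu> \<inter> T" \<mu>] finite_support
      by (simp add: sum.inter_restrict[symmetric] measure_Int_set_pmf Int_commute)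
    also have "(1 - s) + (2 * s - 1) * t \<le> (1 - s) + (2 * s - 1) * (1 - p)"
      using s \<open>t \<le> 1 - p\<close> by (intro add_left_mono mult_left_mono) auto
    also have "\<dots> = s - (2 * s - 1) * p" by (simp add: algebra_simps)
    \<comment> \<open>From \<open>s > 3 / 4\<close> follow \<open>2 * s - 1 \<ge> 1 / 2\<close>, a
      loss of \<open>p / 2\<close> in this step, and the choice of the second branch of the maximum
      in the bound on \<open>s\<close>.\<close>
    also have "\<dots> \<le> s - 1 / 2 * p"
      using s p by (intro diff_left_mono mult_right_mono) auto
    also have "\<dots> \<le> 1 - real (Suc j) * p / 2"
      using s by (auto simp: max_def field_simps split: if_splits)
    finally show ?thesis by simp
  qed
qed

end

section \<open>The inverse theorem for walks\<close>

text \<open>Discrete form of the fact that a decay rate of at least \<open>c\<close> times the cube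
  makes the inverse square grow linearly. The proof multiplies the drop \<open>a - b\<close> by
  \<open>a + b \<ge> a\<close>.\<close>

lemma inverse_square_decay:
  fixes a b c :: real
  assumes "0 < b" "0 < c" "c * a ^ 3 \<le> a - b" "b \<le> a"
  shows "1 / a\<^sup>2 + c \<le> 1 / b\<^sup>2"
proof -
  have "0 < a" using assms by linarith
  have "c * a\<^sup>2 * b\<^sup>2 \<le> c * a\<^sup>2 * a\<^sup>2"
    using assms by (intro mult_left_mono power_mono) auto
  also have "\<dots> = c * a ^ 3 * a" by (simp add: power2_eq_square power3_eq_cube)
  also have "\<dots> \<le> (a - b) * (a + b)"
    using assms \<open>0 < a\<close> by (intro mult_mono) auto
  finally have "b\<^sup>2 + c * a\<^sup>2 * b\<^sup>2 \<le> a\<^sup>2" by (simp add: power2_eq_square algebra_simps)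
  then show ?thesis using \<open>0 < a\<close> \<open>0 < b\<close> by (simp add: field_simps)
qed

context symmetric_walk
begin

text \<open>Each block of \<open>k\<close> in the half-length lets \<open>return_decay\<close> add
  1/2048 to the inverse square of the return probability.\<close>

lemma return_bound:
  assumes esc: "\<And>H. subgroup H G \<Longrightarrow> finite H \<Longrightarrow> card H \<le> N \<Longrightarrow>
      measure (measure_pmf (walk \<mu> (k + k))) H \<le> 3 / 4"
    and "0 < pmf (walk \<mu> (J * k + J * k)) \<one>" "2 / pmf (walk \<mu> (J * k + J * k)) \<one> \<le> real N"
  shows "real J / 2048 \<le> 1 / (pmf (walk \<mu> (J * k + J * k)) \<one>)\<^sup>2"
  using assms(2,3)
proof (induction J)
  case (Suc J)
  define w where "w J = pmf (walk \<mu> (J * k + J * k)) \<one>" for J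
  note prems = Suc.prems[folded w_def]
  have le: "w (Suc J) \<le> w J" unfolding w_def by (rule return_antimono) simp
  then have pos: "0 < w J" using prems by linarith
  \<comment> \<open>The size condition is assumed at the final time only; monotonicity of the return
    probabilities passes it to all earlier ones.\<close>
  have "2 / w J \<le> 2 / w (Suc J)"
    using le prems by (intro divide_left_mono) auto
  then have small: "2 / w J \<le> real N" using prems by linarith
  have "w J ^ 3 / 2048 \<le> w J - pmf (walk \<mu> ((J * k + k) + (J * k + k))) \<one>"
    unfolding w_def by (rule return_decay[OF esc]) (use small in \<open>auto simp: w_def\<close>)
  then have "1 / 2048 * w J ^ 3 \<le> w J - w (Suc J)"
    by (simp add: w_def add.commute)
  then have "1 / (w J)\<^sup>2 + 1 / 2048 \<le> 1 / (w (Suc J))\<^sup>2"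
    by (intro inverse_square_decay) (use prems le in auto)
  moreover have "real J / 2048 \<le> 1 / (w J)\<^sup>2"
    using Suc.IH pos small by (simp add: w_def)
  ultimately show ?case unfolding w_def[symmetric] by simp
qed simp

text \<open>The symmetric part \<open>S\<close> of \<open>yH\<close> satisfies \<open>SS \<subseteq> H\<close>. For \<open>x \<in> S\<close> the element \<open>x\<close> normalizes
  \<open>H \<inter> x\<inverse>Hx\<close> and \<open>x\<^sup>2\<close> lies in it, so together with its coset by \<open>x\<close> it forms a group containing \<open>S\<close>.\<close>

lemma heavy_coset_imp_heavy_subgroup:
  assumes H: "subgroup H G" "finite H" and y: "y \<in> carrier G"
    and heavy: "measure \<mu> ((\<lambda>h. y \<otimes> h) ` H) > 1 - q" and q: "q \<le> 1 / 2"
  obtains L where "subgroup L G" "finite L" "card L \<le> 2 * card H" "measure \<mu> L > 1 - 2 * q"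
proof -
  let ?A = "(\<lambda>h. y \<otimes> h) ` H"
  let ?B = "(\<lambda>g. inv g) -` ?A"
  define S where "S = carrier G \<inter> (?A \<inter> ?B)"
  have Hc: "H \<subseteq> carrier G" using H(1) by (rule subgroup.subset)
  note Hm = subgroup.m_closed[OF H(1)] and Hi = subgroup.m_inv_closed[OF H(1)]
  \<comment> \<open>By symmetry of \<mu> the inverse of the coset is equally heavy, so the
    intersection misses less than \<open>2 * q\<close>.\<close>
  have "measure \<mu> ?B = measure \<mu> ?A"
    using symmetric by (metis measure_map_pmf)
  moreover have "measure \<mu> ?A + measure \<mu> ?B - measure \<mu> (?A \<inter> ?B) \<le> 1"
    using measure_pmf.prob_le_1[of \<mu> "?A \<union> ?B"] 
    by (subst (asm) measure_pmf.finite_measure_Union') (auto simp: measure_pmf.finite_measure_Diff' Int_commute)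
  moreover have "measure \<mu> (?A \<inter> ?B) = measure \<mu> S"
  proof -
    have "?A \<inter> ?B \<inter> set_pmf \<mu> = S \<inter> set_pmf \<mu>"
      using support_carrier by (auto simp: S_def)
    then show ?thesis by (metis measure_Int_set_pmf)
  qed
  ultimately have S: "measure \<mu> S > 1 - 2 * q" using heavy by linarith
  then have "S \<noteq> {}" using q by auto
  then obtain x where x: "x \<in> S" by auto
  have xc: "x \<in> carrier G" using x by (auto simp: S_def)
  have Sinv: "inv s \<in> S" if "s \<in> S" for s using that by (auto simp: S_def)
  have SS: "s \<otimes> t \<in> H" if "s \<in> S" "t \<in> S" for s t
  proof -
    from that obtain h where h: "h \<in> H" "t = y \<otimes> h" by (auto simp: S_def)
    from that obtain k where k: "k \<in> H" "inv s = y \<otimes> k" by (auto simp: S_def)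
    have "s \<in> carrier G" using that by (auto simp: S_def)
    then have "s = inv (y \<otimes> k)" using k(2) by (metis inv_inv)
    then have "s \<otimes> t = inv k \<otimes> h"
      using h k y Hc by (simp add: inv_mult_group m_assoc cancel_inv subset_iff)
    then show ?thesis using Hm[OF Hi[OF k(1)] h(1)] by simp
  qed
  have xx: "x \<otimes> x \<in> H" using SS x by auto
  define K where "K = {h \<in> H. x \<otimes> h \<otimes> inv x \<in> H}"
  define L where "L = K \<union> (\<lambda>h. x \<otimes> h) ` K"
  have KH: "K \<subseteq> H" by (auto simp: K_def)
  have Kc: "K \<subseteq> carrier G" using KH Hc by auto
  have Kmult: "h \<otimes> k \<in> K" if hk: "h \<in> K" "k \<in> K" for h k
  proof -
    have "x \<otimes> (h \<otimes> k) \<otimes> inv x = (x \<otimes> h \<otimes> inv x) \<otimes> (x \<otimes> k \<otimes> inv x)"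
      using hk Kc xc by (simp add: m_assoc cancel_inv subset_iff)
    then show ?thesis using hk Hm by (simp add: K_def)
  qed
  have Kinv: "inv h \<in> K" if h: "h \<in> K" for h
  proof -
    have "x \<otimes> inv h \<otimes> inv x = inv (x \<otimes> h \<otimes> inv x)"
      using h Kc xc by (simp add: inv_mult_group m_assoc subset_iff)
    then show ?thesis using h Hi by (simp add: K_def)
  qed
  have xxK: "x \<otimes> x \<in> K" using xx xc by (simp add: K_def m_assoc)
  have Kconj: "x \<otimes> h \<otimes> inv x \<in> K" if h: "h \<in> K" for h
  proof -
    have "x \<otimes> (x \<otimes> h \<otimes> inv x) \<otimes> inv x = (x \<otimes> x) \<otimes> h \<otimes> inv (x \<otimes> x)"
      using h Kc xc by (simp add: inv_mult_group m_assoc subset_iff)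
    also have "\<dots> \<in> H" using Hm Hi xx h KH by (simp add: subset_iff)
    finally show ?thesis using h by (simp add: K_def)
  qed
  \<comment> \<open>Conjugation by \<open>inv x\<close> is conjugation by \<open>x\<close> followed
    by conjugation by \<open>inv (x \<otimes> x)\<close>, and \<open>x \<otimes> x\<close> lies in
    \<open>K\<close>.\<close>
  have Kconj': "inv x \<otimes> h \<otimes> x \<in> K" if h: "h \<in> K" for h
  proof -
    have "inv x \<otimes> h \<otimes> x = inv (x \<otimes> x) \<otimes> (x \<otimes> h \<otimes> inv x) \<otimes> (x \<otimes> x)"
      using h Kc xc by (simp add: inv_mult_group m_assoc subset_iff cancel_inv)
    then show ?thesis using Kmult Kinv xxK Kconj h by simp
  qed
  have "subgroup L G"
  proof (rule subgroupI)
    show "L \<subseteq> carrier G" using Kc xc by (auto simp: L_def)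
    show "L \<noteq> {}" using xxK by (auto simp: L_def)
    show "inv a \<in> L" if "a \<in> L" for a
      using that unfolding L_def
    proof
      assume "a \<in> (\<lambda>h. x \<otimes> h) ` K"
      then obtain h where h: "h \<in> K" "a = x \<otimes> h" by auto
      have "inv a = x \<otimes> (inv (x \<otimes> x) \<otimes> (x \<otimes> inv h \<otimes> inv x))"
        using h Kc xc by (simp add: inv_mult_group m_assoc subset_iff cancel_inv)
      moreover have "inv (x \<otimes> x) \<otimes> (x \<otimes> inv h \<otimes> inv x) \<in> K"
        using Kmult Kinv xxK Kconj h by simp
      ultimately show "inv a \<in> K \<union> (\<lambda>h. x \<otimes> h) ` K" by auto
    qed (use Kinv in auto)
    show "a \<otimes> b \<in> L" if ab: "a \<in> L" "b \<in> L" for a b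
    proof -
      from ab consider "a \<in> K" "b \<in> K"
        | h where "h \<in> K" "a = x \<otimes> h" "b \<in> K"
        | h where "h \<in> K" "b = x \<otimes> h" "a \<in> K"
        | h k where "h \<in> K" "a = x \<otimes> h" "k \<in> K" "b = x \<otimes> k"
        by (auto simp: L_def)
      then show ?thesis
      proof cases
        case 1
        then show ?thesis using Kmult by (auto simp: L_def)
      next
        case (2 h)
        then have "a \<otimes> b = x \<otimes> (h \<otimes> b)" using Kc xc by (simp add: m_assoc subset_iff)
        then show ?thesis using Kmult 2 by (auto simp: L_def)
      next
        case (3 h)
        then have "a \<otimes> b = x \<otimes> ((inv x \<otimes> a \<otimes> x) \<otimes> h)"
          using Kc xc by (simp add: m_assoc subset_iff cancel_inv)
        then show ?thesis using Kmult Kconj' 3 by (auto simp: L_def)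
      next
        case (4 h k)
        then have "a \<otimes> b = (x \<otimes> x) \<otimes> ((inv x \<otimes> h \<otimes> x) \<otimes> k)"
          using Kc xc by (simp add: m_assoc subset_iff cancel_inv)
        then show ?thesis using Kmult Kconj' xxK 4 by (auto simp: L_def)
      qed
    qed
  qed
  moreover have finK: "finite K" using KH H(2) by (rule finite_subset)
  then have "finite L" by (simp add: L_def)
  moreover have "card L \<le> 2 * card H"
  proof -
    have "card L \<le> card K + card ((\<lambda>h. x \<otimes> h) ` K)" unfolding L_def by (rule card_Un_le)
    also have "\<dots> \<le> card K + card K" using card_image_le[OF finK] by simp
    also have "\<dots> \<le> 2 * card H" using card_mono[OF H(2) KH] by simp
    finally show ?thesis .
  qed
  \<comment> \<open>As \<open>S\<close> is closed under inverses, both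
    \<open>inv x \<otimes> s\<close> and \<open>s \<otimes> inv x\<close> are products of two
    elements of \<open>S\<close>, hence lie in \<open>H\<close>; together they put
    \<open>inv x \<otimes> s\<close> into \<open>K\<close>.\<close>
  moreover have "S \<subseteq> L"
  proof
    fix s assume s: "s \<in> S"
    then have sc: "s \<in> carrier G" by (auto simp: S_def)
    have "inv x \<otimes> s \<in> H" using SS Sinv x s by auto
    moreover have "x \<otimes> (inv x \<otimes> s) \<otimes> inv x \<in> H"
      using SS[OF s Sinv[OF x]] sc xc by (simp add: cancel_inv)
    ultimately have "inv x \<otimes> s \<in> K" by (simp add: K_def)
    moreover have "s = x \<otimes> (inv x \<otimes> s)" using sc xc by (simp add: cancel_inv)
    ultimately show "s \<in> L" by (auto simp: L_def)
  qed
  then have "measure \<mu> S \<le> measure \<mu> L" by (intro measure_pmf.finite_measure_mono) auto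
  ultimately show ?thesis using that S by (meson less_le_trans)
qed

lemma inverse_littlewood_offord_walk:
  fixes \<epsilon> :: real
  assumes n: "n \<ge> 2" and \<epsilon>: "0 < \<epsilon>" "\<epsilon> \<le> 1" and large: "real n \<ge> 16392 / \<epsilon> ^ 4"
    and x: "x \<in> carrier G" and conc: "pmf (walk \<mu> n) x > 1 / (\<epsilon> * sqrt (real n))"
  shows "\<exists>H. subgroup H G \<and> finite H \<and> real (card H) \<le> 16392 * \<epsilon> * sqrt (real n) \<and>
      measure \<mu> H \<ge> 1 - 16392 * \<epsilon>\<^sup>2"
proof (rule ccontr)
  assume contra: "\<not> ?thesis"
  define r where "r = \<epsilon> * sqrt (real n)"
  define p where "p = 16392 * \<epsilon>\<^sup>2"
  have r2: "r\<^sup>2 = \<epsilon>\<^sup>2 * real n" by (simp add: r_def power_mult_distrib)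
  have r0: "r > 0" using n \<epsilon> by (simp add: r_def)
  \<comment> \<open>Largeness of \<open>n\<close> gives \<open>r \<ge> 1\<close>, which brings the
    trivial subgroup within the order bound and absorbs rounding errors.\<close>
  have "16392 \<le> \<epsilon> ^ 4 * real n" using large \<epsilon> by (simp add: field_simps)
  also have "\<dots> \<le> \<epsilon>\<^sup>2 * real n"
    using \<epsilon> by (intro mult_right_mono power_decreasing) auto
  finally have r2_ge: "1 \<le> r\<^sup>2" unfolding r2 by simp
  then have r1: "1 \<le> r" using r0 by (simp add: power2_eq_square) (smt (verit) mult_less_cancel_left1)
  have light: "measure \<mu> H < 1 - p" if "subgroup H G" "finite H" "real (card H) \<le> 16392 * r" for H
    using contra that unfolding r_def p_def by (metis mult.assoc not_less)
  have p: "0 < p" "p < 1"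
  proof -
    show "0 < p" using \<epsilon> by (simp add: p_def)
    \<comment> \<open>The trivial subgroup is light, so its nonnegative mass lies below
      \<open>1 - p\<close>.\<close>
    have "0 \<le> measure \<mu> {\<one>}" by simp
    also have "\<dots> < 1 - p" by (rule light) (use triv_subgroup r1 in auto)
    finally show "p < 1" by simp
  qed
  \<comment> \<open>Half the order bound \<open>16392 * r\<close>, because passing from a heavy
    coset to a heavy subgroup may double the order; that passage also halves the defect to
    \<open>p / 2\<close>.\<close>
  define N where "N = nat \<lfloor>8196 * r\<rfloor>"
  have N: "real N \<le> 8196 * r" "8196 * r - 1 \<le> real N" using r0 by (auto simp: N_def)
  have coset: "measure \<mu> ((\<lambda>h. y \<otimes> h) ` H) \<le> 1 - p / 2"
    if H: "subgroup H G" "finite H" "card H \<le> N" and y: "y \<in> carrier G" for H y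
  proof (rule ccontr)
    assume "\<not> ?thesis"
    then have "measure \<mu> ((\<lambda>h. y \<otimes> h) ` H) > 1 - p / 2" by simp
    then obtain L where L: "subgroup L G" "finite L" "card L \<le> 2 * card H" "measure \<mu> L > 1 - 2 * (p / 2)"
      by (rule heavy_coset_imp_heavy_subgroup[OF H(1,2) y]) (use p in auto)
    have "real (card L) \<le> 16392 * r" using L(3) H(3) N(1) by linarith
    from light[OF L(1,2) this] L(4) show False by simp
  qed
  \<comment> \<open>With defect \<open>p / 2\<close> a coset loses \<open>p / 4\<close> per step,
    hence \<open>k * p / 2 \<ge> 1 / 2\<close> in \<open>k + k\<close> steps, enough to reach
    3/4.\<close>
  define k where "k = nat \<lceil>1 / p\<rceil>"
  have k: "1 / p \<le> real k" "real k \<le> 1 / p + 1" using p by (auto simp: k_def) 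
  have k2: "real k \<le> 2 / p" using k(2) p by (simp add: field_simps)
  have k0: "0 < k" using k(1) p by (metis divide_pos_pos less_le_trans of_nat_0_less_iff zero_less_one)
  have esc: "measure (walk \<mu> (k + k)) H \<le> 3 / 4"
    if H: "subgroup H G" "finite H" "card H \<le> N" for H
  proof -
    have "(\<lambda>h. \<one> \<otimes> h) ` H = (\<lambda>h. h) ` H"
      by (intro image_cong refl) (use subgroup.subset[OF H(1)] in auto)
    then have "measure (walk \<mu> (k + k)) H \<le> max (3 / 4) (1 - real (k + k) * (p / 2) / 2)"
      using coset_escape[OF coset, of N H \<one> "k + k"] H p by simp
    also have "real (k + k) * (p / 2) / 2 = real k * p / 2" by simp
    also have "1 - real k * p / 2 \<le> 3 / 4" using k(1) p by (simp add: field_simps)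
    finally show ?thesis by simp
  qed
  \<comment> \<open>The number of whole blocks of length \<open>k\<close> in \<open>n div 2\<close>;
    dropping the remainder only increases the return probability.\<close>
  define J where "J = (n div 2) div k"
  define w where "w = pmf (walk \<mu> (J * k + J * k)) \<one>"
  have "1 / r < pmf (walk \<mu> n) x" using conc by (simp add: r_def)
  also have "\<dots> \<le> pmf (walk \<mu> (n div 2 + n div 2)) \<one>" by (rule pmf_walk_le_half[OF x])
  also have "\<dots> \<le> w" unfolding w_def by (rule return_antimono) (simp add: J_def)
  finally have w: "1 / r < w" .
  then have w0: "0 < w" using r0 by (meson divide_pos_pos less_trans zero_less_one)
  have "1 / w < r" using w w0 r0 by (simp add: field_simps)
  then have "2 / w \<le> real N" using N(2) r1 by simp
  then have "real J / 2048 \<le> 1 / w\<^sup>2"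
    using return_bound[OF esc, of N J] w0 by (simp add: w_def)
  also have "\<dots> = (1 / w)\<^sup>2" by (simp add: power_divide)
  also have "\<dots> < r\<^sup>2" using \<open>1 / w < r\<close> w0 by (intro power_strict_mono) auto
  finally have J_upper: "real J < 2048 * r\<^sup>2" by simp
  have "n div 2 < k * (J + 1)" unfolding J_def using k0
    by (metis Suc_eq_plus1 dividend_less_times_div mult_Suc_right add.commute)
  then have "real (n div 2) < real k * (real J + 1)"
    by (metis of_nat_1 of_nat_add of_nat_less_iff of_nat_mult)
  also have "\<dots> \<le> 2 / p * (real J + 1)" using k2 by (intro mult_right_mono) auto
  finally have J_lower: "real (n div 2) * p < 2 * (real J + 1)" using p by (simp add: field_simps)
  \<comment> \<open>The constant is fixed here as \<open>16392 = 4 * 4098\<close>: the bounds on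
    \<open>J\<close> give \<open>4098 * r\<^sup>2 < 4096 * r\<^sup>2 + 2\<close>, contradicting
    \<open>r\<^sup>2 \<ge> 1\<close>.\<close>
  have "4098 * r\<^sup>2 = real n / 4 * p" by (simp add: r2 p_def)
  also have "\<dots> \<le> real (n div 2) * p" using n p by (intro mult_right_mono) auto
  also note J_lower
  finally show False using J_upper r2_ge by argo
qed

end

section \<open>Products of independent signed elements\<close>

text \<open>A uniform index into a listing accounts for repetitions and reduces multisets to uniform
  laws on sets.\<close>

lemma pmf_of_multiset_eq_map_nth:
  assumes "xs \<noteq> []"
  shows "pmf_of_multiset (mset xs) = map_pmf (\<lambda>i. xs ! i) (pmf_of_set {0..<length xs})"
proof -
  have "mset xs = mset (map (\<lambda>i. xs ! i) [0..<length xs])" by (simp add: map_nth)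
  also have "\<dots> = image_mset (\<lambda>i. xs ! i) (mset_set {0..<length xs})" by (simp add: mset_upt)
  finally show ?thesis using assms by (subst map_pmf_of_set) auto
qed

lemma map_pmf_of_multiset:
  assumes "M \<noteq> {#}"
  shows "map_pmf f (pmf_of_multiset M) = pmf_of_multiset (image_mset f M)"
proof -
  obtain xs where xs: "mset xs = M" by (metis ex_mset)
  then have "xs \<noteq> []" using assms by auto
  then have "map_pmf f (pmf_of_multiset (mset xs))
      = map_pmf (\<lambda>i. map f xs ! i) (pmf_of_set {0..<length xs})"
    by (subst pmf_of_multiset_eq_map_nth)
       (auto simp: map_pmf_comp intro!: map_pmf_cong)
  also have "\<dots> = pmf_of_multiset (mset (map f xs))"
    using \<open>xs \<noteq> []\<close> by (subst pmf_of_multiset_eq_map_nth) auto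
  finally show ?thesis using xs by simp
qed

lemma measure_pmf_of_multiset:
  assumes "M \<noteq> {#}"
  shows "measure (measure_pmf (pmf_of_multiset M)) S = real (size {#x \<in># M. x \<in> S#}) / real (size M)"
proof -
  obtain xs where xs: "mset xs = M" by (metis ex_mset)
  then have "xs \<noteq> []" using assms by auto
  then have "measure (measure_pmf (pmf_of_multiset (mset xs))) S
      = real (card ({0..<length xs} \<inter> (\<lambda>i. xs ! i) -` S)) / real (length xs)"
    by (simp add: pmf_of_multiset_eq_map_nth measure_pmf_of_set)
  also have "{0..<length xs} \<inter> (\<lambda>i. xs ! i) -` S = {i. i < length xs \<and> xs ! i \<in> S}" by auto
  also have "card \<dots> = size {#x \<in># mset xs. x \<in> S#}"
    by (simp add: length_filter_conv_card flip: mset_filter)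
  finally show ?thesis using xs by auto
qed

lemma size_signed_elements: "size (signed_elements G n A) = 2 * n"
  by (simp add: signed_elements_def)

lemma set_signed_elements:
  "set_mset (signed_elements G n A) = A ` {1..n} \<union> (\<lambda>i. inv\<^bsub>G\<^esub> (A i)) ` {1..n}"
  by (simp add: signed_elements_def)

lemma (in group) foldr_mult_closed:
  "set xs \<subseteq> carrier G \<Longrightarrow> foldr (\<otimes>) xs \<one> \<in> carrier G"
  by (induction xs) auto

text \<open>The definitions in \<open>Defs\<close> speak about the non-extensible record type \<open>'a monoid\<close>.\<close>

locale plain_group = group G for G :: "'a monoid" (structure)
begin

lemma set_signed_elements_carrier:
  "(\<And>i. i \<in> {1..n} \<Longrightarrow> A i \<in> carrier G) \<Longrightarrow> set_mset (signed_elements G n A) \<subseteq> carrier G"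
  by (auto simp: set_signed_elements)

text \<open>Inversion swaps the two halves of the list.\<close>

lemma symmetric_walk_signed_elements:
  assumes "n \<ge> 1" "\<And>i. i \<in> {1..n} \<Longrightarrow> A i \<in> carrier G"
  shows "symmetric_walk G (pmf_of_multiset (signed_elements G n A))"
proof -
  have ne: "signed_elements G n A \<noteq> {#}"
    using size_signed_elements[of G n A] assms(1) by auto
  have "image_mset (\<lambda>x. inv x) (signed_elements G n A) = signed_elements G n A"
  proof -
    have "image_mset (\<lambda>i. inv (inv (A i))) (mset_set {1..n}) = image_mset A (mset_set {1..n})"
      by (rule image_mset_cong) (use assms in auto)
    then show ?thesis
      by (simp add: signed_elements_def multiset.map_comp comp_def add.commute)
  qed
  then show ?thesis
    using ne set_signed_elements_carrier[OF assms(2)]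
    by unfold_locales (auto simp: map_pmf_of_multiset)
qed

text \<open>A subgroup contains \<open>A i\<close> exactly when it contains the inverse, so both
  halves of the list count equally and the factor 2 cancels.\<close>

lemma measure_signed_elements_subgroup:
  assumes "n \<ge> 1" "\<And>i. i \<in> {1..n} \<Longrightarrow> A i \<in> carrier G" "subgroup H G"
  shows "measure (pmf_of_multiset (signed_elements G n A)) H
    = real (card {i \<in> {1..n}. A i \<in> H}) / real n"
proof -
  have ne: "signed_elements G n A \<noteq> {#}"
    using size_signed_elements[of G n A] assms(1) by auto
  have "inv (A i) \<in> H \<longleftrightarrow> A i \<in> H" if "i \<in> {1..n}" for i
    using assms(2)[OF that] assms(3) by (metis inv_inv subgroup.m_inv_closed)
  then have "{i \<in> {1..n}. inv (A i) \<in> H} = {i \<in> {1..n}. A i \<in> H}" by auto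
  then have "size {#x \<in># signed_elements G n A. x \<in> H#} = 2 * card {i \<in> {1..n}. A i \<in> H}"
    by (simp add: signed_elements_def filter_mset_image_mset filter_mset_mset_set)
  then show ?thesis
    by (simp add: measure_pmf_of_multiset[OF ne] size_signed_elements)
qed

text \<open>The extra constraint on \<open>J\<close> makes the induction on \<open>l\<close> go through: conditioning on the first factor
  moves its index into \<open>J\<close>.\<close>

lemma joint_law_foldr:
  fixes M :: "'w measure" and X :: "'i \<Rightarrow> 'w \<Rightarrow> 'a"
  assumes "symmetric_walk G \<mu>" and "prob_space M"
    and indep: "prob_space.indep_vars M (\<lambda>_. count_space (set_pmf \<mu>)) X I"
    and law: "\<And>i s. i \<in> I \<Longrightarrow> measure M (X i -` {s} \<inter> space M) = pmf \<mu> s"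
    and I: "finite I"
    and l: "distinct l" "set l \<subseteq> I" and J: "J \<subseteq> I - set l" "v ` J \<subseteq> set_pmf \<mu>"
    and B: "B \<in> carrier G"
  defines "E \<equiv> {\<omega> \<in> space M. (\<forall>j\<in>J. X j \<omega> = v j) \<and> foldr (\<otimes>) (map (\<lambda>i. X i \<omega>) l) \<one> = B}"
  shows "E \<in> sets M \<and> measure M E = (\<Prod>j\<in>J. pmf \<mu> (v j)) * pmf (walk \<mu> (length l)) B"
proof -
  interpret symmetric_walk G \<mu> by fact
  interpret prob_space M by fact
  have rv: "X i \<in> measurable M (count_space (set_pmf \<mu>))" if "i \<in> I" for i
    using indep that by (simp add: indep_vars_def)
  have XS: "X i \<omega> \<in> set_pmf \<mu>" if "i \<in> I" "\<omega> \<in> space M" for i \<omega>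
    using measurable_space[OF rv[OF that(1)] that(2)] by simp
  show ?thesis
    using l J B unfolding E_def
  proof (induction l arbitrary: J v B)
    case Nil
    have finJ: "finite J" using Nil.prems I by (auto intro: finite_subset)
    have event: "{\<omega> \<in> space M. \<forall>j\<in>J. X j \<omega> = v j} \<in> sets M"
    proof (rule sets.sets_Collect_finite_All[OF _ finJ])
      fix j assume "j \<in> J"
      then have "X j -` {v j} \<inter> space M \<in> sets M"
        using Nil.prems by (intro measurable_sets[OF rv]) auto
      moreover have "X j -` {v j} \<inter> space M = {\<omega> \<in> space M. X j \<omega> = v j}" by auto
      ultimately show "{\<omega> \<in> space M. X j \<omega> = v j} \<in> sets M" by simp
    qed
    have "prob {\<omega> \<in> space M. \<forall>j\<in>J. X j \<omega> = v j} = (\<Prod>j\<in>J. pmf \<mu> (v j))"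
    \<comment> \<open>The product rule for independent variables is stated for nonempty index sets;
      without constraints the event is the whole space.\<close>
    proof (cases "J = {}")
      case True
      then show ?thesis using prob_space by simp
    next
      case False
      have "{\<omega> \<in> space M. \<forall>j\<in>J. X j \<omega> = v j} = (\<Inter>j\<in>J. X j -` {v j} \<inter> space M)"
        using False by auto
      also have "prob \<dots> = (\<Prod>j\<in>J. prob (X j -` {v j} \<inter> space M))"
        by (rule indep_varsD[OF indep False finJ]) (use Nil.prems in auto)
      also have "\<dots> = (\<Prod>j\<in>J. pmf \<mu> (v j))"
        by (rule prod.cong) (use Nil.prems law in auto)
      finally show ?thesis .
    qed
    then show ?case using event by (cases "B = \<one>") (auto simp: pmf_return)
  next
    case (Cons a l)
    let ?fold = "\<lambda>\<omega>. foldr (\<otimes>) (map (\<lambda>i. X i \<omega>) l) \<one>"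
    \<comment> \<open>The event with the first factor fixed to \<open>s\<close>: the index
      \<open>a\<close> joins the constraints and the remaining product must equal
      \<open>inv s \<otimes> B\<close>. These events partition the original one.\<close>
    define F where "F s = {\<omega> \<in> space M. (\<forall>j\<in>insert a J. X j \<omega> = (v(a := s)) j) \<and> ?fold \<omega> = inv s \<otimes> B}" for s
    have a: "a \<in> I" "a \<notin> J" "a \<notin> set l" using Cons.prems by auto
    have finJ: "finite J" using Cons.prems I by (auto intro: finite_subset)
    have F: "F s \<in> sets M \<and> measure M (F s)
        = (\<Prod>j\<in>J. pmf \<mu> (v j)) * (pmf \<mu> s * pmf (walk \<mu> (length l)) (inv s \<otimes> B))"
      if s: "s \<in> set_pmf \<mu>" for s
    proof -
      have "F s \<in> sets M \<and> measure M (F s)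
        = (\<Prod>j\<in>insert a J. pmf \<mu> ((v(a := s)) j)) * pmf (walk \<mu> (length l)) (inv s \<otimes> B)"
        unfolding F_def by (rule Cons.IH) (use Cons.prems s support_carrier in auto)
      moreover have "(\<Prod>j\<in>insert a J. pmf \<mu> ((v(a := s)) j)) = pmf \<mu> s * (\<Prod>j\<in>J. pmf \<mu> (v j))"
        using a finJ by (auto intro!: prod.cong)
      ultimately show ?thesis by simp
    qed
    have fold_closed: "?fold \<omega> \<in> carrier G" if "\<omega> \<in> space M" for \<omega>
    proof (rule foldr_mult_closed)
      show "set (map (\<lambda>i. X i \<omega>) l) \<subseteq> carrier G"
        using XS[OF _ that] Cons.prems(2) support_carrier by fastforce
    qed
    have "{\<omega> \<in> space M. (\<forall>j\<in>J. X j \<omega> = v j) \<and> foldr (\<otimes>) (map (\<lambda>i. X i \<omega>) (a # l)) \<one> = B}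
        = (\<Union>s\<in>set_pmf \<mu>. F s)" (is "?E = _")
    proof (intro equalityI subsetI)
      fix \<omega> assume \<omega>: "\<omega> \<in> ?E"
      then have Xa: "X a \<omega> \<in> set_pmf \<mu>" using XS a by auto
      then have "X a \<omega> \<in> carrier G" using support_carrier by auto
      then have "?fold \<omega> = inv (X a \<omega>) \<otimes> B"
        using \<omega> fold_closed[of \<omega>] by (auto simp: cancel_inv)
      then show "\<omega> \<in> (\<Union>s\<in>set_pmf \<mu>. F s)" using Xa \<omega> a(2) by (auto simp: F_def)
    next
      fix \<omega> assume "\<omega> \<in> (\<Union>s\<in>set_pmf \<mu>. F s)"
      then obtain s where s: "s \<in> set_pmf \<mu>" "\<omega> \<in> F s" by auto
      then have "X a \<omega> \<otimes> ?fold \<omega> = s \<otimes> (inv s \<otimes> B)" by (simp add: F_def)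
      also have "\<dots> = B" using s support_carrier Cons.prems by (auto simp: cancel_inv)
      finally have "X a \<omega> \<otimes> ?fold \<omega> = B" .
      moreover have "\<forall>j\<in>J. X j \<omega> = v j" using s a(2) by (auto simp: F_def)
      ultimately show "\<omega> \<in> ?E" using s by (auto simp: F_def)
    qed
    moreover have "measure M (\<Union>s\<in>set_pmf \<mu>. F s) = (\<Sum>s\<in>set_pmf \<mu>. measure M (F s))"
    proof (rule finite_measure_finite_Union[OF finite_support])
      show "F ` set_pmf \<mu> \<subseteq> events" using F by auto
      show "disjoint_family_on F (set_pmf \<mu>)" by (auto simp: disjoint_family_on_def F_def)
    qed
    moreover have "(\<Sum>s\<in>set_pmf \<mu>. measure M (F s))
        = (\<Prod>j\<in>J. pmf \<mu> (v j)) * pmf (walk \<mu> (length (a # l))) B"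
      using F Cons.prems
      by (simp add: pmf_conv finite_support support_carrier set_walk_carrier sum_distrib_left)
    moreover have "(\<Union>s\<in>set_pmf \<mu>. F s) \<in> sets M"
      using F finite_support by auto
    ultimately show ?case by simp
  qed
qed

lemma measure_ordered_prod:
  assumes "n \<ge> 1" "\<And>i. i \<in> {1..n} \<Longrightarrow> A i \<in> carrier G"
    and iid: "iid_uniform_signed G n A M X" and B: "B \<in> carrier G"
  shows "measure M {\<omega> \<in> space M. ordered_prod G n (\<lambda>i. X i \<omega>) = B}
      = pmf (walk (pmf_of_multiset (signed_elements G n A)) n) B"
proof -
  let ?\<mu> = "pmf_of_multiset (signed_elements G n A)"
  have ne: "signed_elements G n A \<noteq> {#}"
    using size_signed_elements[of G n A] assms(1) by auto
  interpret prob_space M using iid by (simp add: iid_uniform_signed_def)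
  have indep: "indep_vars (\<lambda>_. count_space (set_pmf ?\<mu>)) X {1..n}"
    using iid ne by (simp add: iid_uniform_signed_def)
  have law: "measure M (X i -` {s} \<inter> space M) = pmf ?\<mu> s" if i: "i \<in> {1..n}" for i s
  proof -
    have "X i \<in> measurable M (count_space (set_pmf ?\<mu>))"
      using indep i by (simp add: indep_vars_def)
    then have "X i \<in> measurable M (count_space UNIV)"
      by (rule measurable_compose[where g = "\<lambda>x. x"]) simp
    then have "measure M (X i -` {s} \<inter> space M) = measure (distr M (count_space UNIV) (X i)) {s}"
      by (simp add: measure_distr)
    also have "\<dots> = pmf ?\<mu> s"
      using iid i by (simp add: iid_uniform_signed_def measure_pmf_single)
    finally show ?thesis .
  qed
  show ?thesis
    \<comment> \<open>With \<open>J = {}\<close> the product over constraints is empty;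
      \<open>undefined\<close> merely fills the place of \<open>v\<close>.\<close>
    using joint_law_foldr[OF symmetric_walk_signed_elements[OF assms(1,2)] prob_space_axioms indep law,
        of "[1..<Suc n]" "{}" undefined B] B
    by (simp add: ordered_prod_def atLeastLessThanSuc_atLeastAtMost del: upt_Suc)
qed

end

lemma ordered_prod_concentration_point:
  assumes "group G" "prob_space M" "r < (SUP B\<in>carrier G. measure M {\<omega> \<in> space M. ordered_prod G n (\<lambda>i. X i \<omega>) = B})"
  obtains B where "B \<in> carrier G" "r < measure M {\<omega> \<in> space M. ordered_prod G n (\<lambda>i. X i \<omega>) = B}"
proof -
  interpret group G by fact
  interpret prob_space M by fact
  have "bdd_above ((\<lambda>B. measure M {\<omega> \<in> space M. ordered_prod G n (\<lambda>i. X i \<omega>) = B}) ` carrier G)"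
    by (rule bdd_aboveI2[where M = 1]) simp
  then show ?thesis
    using that assms(3) by (subst (asm) less_cSUP_iff) auto
qed

lemma admissible_constant_16392: "admissible_constant TYPE('g) TYPE('w) 16392"
  unfolding admissible_constant_def
proof (intro allI impI)
  fix n :: nat and \<epsilon> :: real and G :: "'g monoid" and A :: "nat \<Rightarrow> 'g"
    and M :: "'w measure" and X :: "nat \<Rightarrow> 'w \<Rightarrow> 'g"
  assume n: "n \<ge> 2" and \<epsilon>: "0 < \<epsilon>" "\<epsilon> \<le> 1" and large: "real n \<ge> 16392 / \<epsilon> ^ 4"
    and G: "group G" and A: "\<forall>i\<in>{1..n}. A i \<in> carrier G"
    and iid: "iid_uniform_signed G n A M X"
    and conc: "(SUP B\<in>carrier G. measure M {\<omega> \<in> space M. ordered_prod G n (\<lambda>i. X i \<omega>) = B})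
      > 1 / (\<epsilon> * sqrt (real n))"
  let ?\<mu> = "pmf_of_multiset (signed_elements G n A)"
  interpret plain_group G by (rule plain_group.intro) fact
  have n1: "n \<ge> 1" using n by simp
  have Ai: "A i \<in> carrier G" if "i \<in> {1..n}" for i using A that by blast
  interpret symmetric_walk G ?\<mu> by (rule symmetric_walk_signed_elements[OF n1 Ai])
  have "prob_space M" using iid by (simp add: iid_uniform_signed_def)
  then obtain B where B: "B \<in> carrier G"
    "1 / (\<epsilon> * sqrt (real n)) < measure M {\<omega> \<in> space M. ordered_prod G n (\<lambda>i. X i \<omega>) = B}"
    using ordered_prod_concentration_point[OF G _ conc] by blast
  then have "1 / (\<epsilon> * sqrt (real n)) < pmf (walk ?\<mu> n) B"
    using measure_ordered_prod[OF n1 Ai iid] by simp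
  then obtain H where H: "subgroup H G" "finite H" "real (card H) \<le> 16392 * \<epsilon> * sqrt (real n)"
    "measure ?\<mu> H \<ge> 1 - 16392 * \<epsilon>\<^sup>2"
    using inverse_littlewood_offord_walk[OF n \<epsilon> large B(1)] by blast
  have "1 - 16392 * \<epsilon>\<^sup>2 \<le> real (card {i \<in> {1..n}. A i \<in> H}) / real n"
    using H(4) measure_signed_elements_subgroup[OF n1 Ai H(1)] by simp
  then have "real (card {i \<in> {1..n}. A i \<in> H}) \<ge> (1 - 16392 * \<epsilon>\<^sup>2) * real n"
    using n by (subst (asm) pos_le_divide_eq) auto
  then show "\<exists>H. subgroup H G \<and> finite H \<and> real (card H) \<le> 16392 * \<epsilon> * sqrt (real n) \<and>
      real (card {i \<in> {1..n}. A i \<in> H}) \<ge> (1 - 16392 * \<epsilon>\<^sup>2) * real n"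
    using H by blast
qed

section \<open>Change of group and probability space\<close>

text \<open>The preimage under \<open>c\<close> of an event of \<open>X j\<close> is an event of the
  composed variable with the same probability, so the product rule carries over to the image
  measure.\<close>

lemma indep_vars_distr:
  assumes M: "prob_space M" and c: "c \<in> measurable M N"
    and X: "\<And>i. i \<in> I \<Longrightarrow> X i \<in> measurable N (K i)"
    and indep: "prob_space.indep_vars M K (\<lambda>i \<omega>. X i (c \<omega>)) I"
  shows "prob_space.indep_vars (distr M N c) K X I"
proof -
  interpret M: prob_space M by fact
  interpret D: prob_space "distr M N c" by (rule M.prob_space_distr) fact
  show ?thesis
    unfolding D.indep_vars_def2
  proof (intro conjI ballI D.indep_setsI)
    fix A J assume J: "J \<noteq> {}" "J \<subseteq> I" "finite J"
      "\<forall>j\<in>J. A j \<in> {X j -` B \<inter> space (distr M N c) |B. B \<in> sets (K j)}"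
    then obtain B where "\<forall>j\<in>J. A j = X j -` B j \<inter> space N \<and> B j \<in> sets (K j)"
      by (simp add: Bex_def Ball_def) metis
    then have B: "\<And>j. j \<in> J \<Longrightarrow> A j = X j -` B j \<inter> space N" "\<And>j. j \<in> J \<Longrightarrow> B j \<in> sets (K j)"
      by auto
    have A: "A j \<in> sets N" if "j \<in> J" for j
      unfolding B(1)[OF that] using that J(2) B(2) by (intro measurable_sets[OF X]) auto
    have vimage: "c -` A j \<inter> space M = (\<lambda>\<omega>. X j (c \<omega>)) -` B j \<inter> space M" if "j \<in> J" for j
      unfolding B(1)[OF that] using measurable_space[OF c] by auto
    have "D.prob (\<Inter>j\<in>J. A j) = M.prob (c -` (\<Inter>j\<in>J. A j) \<inter> space M)"
      using J(1,3) A by (intro measure_distr c) auto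
    also have "c -` (\<Inter>j\<in>J. A j) \<inter> space M = (\<Inter>j\<in>J. c -` A j \<inter> space M)"
      using J(1) by auto
    also have "\<dots> = (\<Inter>j\<in>J. (\<lambda>\<omega>. X j (c \<omega>)) -` B j \<inter> space M)"
      by (intro INF_cong refl vimage)
    also have "M.prob \<dots> = (\<Prod>j\<in>J. M.prob ((\<lambda>\<omega>. X j (c \<omega>)) -` B j \<inter> space M))"
      using J B(2) by (intro M.indep_varsD[OF indep]) auto
    also have "\<dots> = (\<Prod>j\<in>J. D.prob (A j))"
      by (intro prod.cong refl) (simp add: measure_distr[OF c A] vimage)
    finally show "D.prob (\<Inter>j\<in>J. A j) = (\<Prod>j\<in>J. D.prob (A j))" .
  qed (use X in auto)
qed

text \<open>The subgroup \<open>K\<close> relabelled by \<phi>, with \<open>inv_into\<close>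
  decoding labels; a faithful copy when \<phi> is injective on \<open>K\<close>. A numbering of a
  countable \<open>K\<close> thus gives a group on \<open>nat\<close>.\<close>

definition transport_group :: "'a monoid \<Rightarrow> 'a set \<Rightarrow> ('a \<Rightarrow> 'b) \<Rightarrow> 'b monoid" where
  "transport_group G K \<phi> = \<lparr>carrier = \<phi> ` K,
     mult = (\<lambda>a b. \<phi> (inv_into K \<phi> a \<otimes>\<^bsub>G\<^esub> inv_into K \<phi> b)), one = \<phi> \<one>\<^bsub>G\<^esub>\<rparr>"

lemma (in group) foldr_mult_append:
  assumes "set xs \<subseteq> carrier G" "set ys \<subseteq> carrier G"
  shows "foldr (\<otimes>) (xs @ ys) \<one> = foldr (\<otimes>) xs \<one> \<otimes> foldr (\<otimes>) ys \<one>"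
  using assms by (induction xs) (simp_all add: m_assoc foldr_mult_closed)

text \<open>Every element is the product of a finite word in the generators and their inverses, and
  there are countably many words.\<close>

lemma (in group) countable_generate:
  assumes "countable S" "S \<subseteq> carrier G"
  shows "countable (generate G S)"
proof -
  define T where "T = S \<union> (\<lambda>x. inv x) ` S"
  have T: "T \<subseteq> carrier G" "countable T" using assms by (auto simp: T_def)
  have "x \<in> (\<lambda>xs. foldr (\<otimes>) xs \<one>) ` lists T" if "x \<in> generate G S" for x
    using that
  proof induction
    case one
    show ?case by (rule image_eqI[of _ _ "[]"]) auto
  next
    case (incl h)
    then show ?case using assms by (intro image_eqI[of _ _ "[h]"]) (auto simp: T_def)
  next
    case (inv h)
    then show ?case using assms by (intro image_eqI[of _ _ "[inv h]"]) (auto simp: T_def)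
  next
    case (eng a b)
    then obtain xs ys where "xs \<in> lists T" "ys \<in> lists T"
      "a = foldr (\<otimes>) xs \<one>" "b = foldr (\<otimes>) ys \<one>" by blast
    moreover from this have "set xs \<subseteq> carrier G" "set ys \<subseteq> carrier G" using T(1) by auto
    ultimately show ?case
      by (intro image_eqI[of _ _ "xs @ ys"]) (auto simp: foldr_mult_append simp del: foldr_append)
  qed
  then show ?thesis
    using countable_lists[OF T(2)] by (meson countable_image countable_subset subsetI)
qed

section \<open>Copies of a group and of its random variables\<close>

locale group_transport = plain_group G for G :: "'a monoid" (structure) +
  fixes K :: "'a set" and \<phi> :: "'a \<Rightarrow> 'b"
  assumes subgroup: "subgroup K G" and inj: "inj_on \<phi> K"
begin

abbreviation "G' \<equiv> transport_group G K \<phi>"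

lemma K_carrier: "K \<subseteq> carrier G"
  using subgroup by (rule subgroup.subset)

lemma K_closed: "\<one> \<in> K" "a \<in> K \<Longrightarrow> b \<in> K \<Longrightarrow> a \<otimes> b \<in> K" "a \<in> K \<Longrightarrow> inv a \<in> K"
  using subgroup by (auto simp: subgroup.one_closed subgroup.m_closed subgroup.m_inv_closed)

lemma transport_simps:
  "carrier G' = \<phi> ` K" "\<one>\<^bsub>G'\<^esub> = \<phi> \<one>"
  "a \<in> K \<Longrightarrow> b \<in> K \<Longrightarrow> \<phi> a \<otimes>\<^bsub>G'\<^esub> \<phi> b = \<phi> (a \<otimes> b)"
  by (simp_all add: transport_group_def inv_into_f_f[OF inj])

lemma group_transport_group: "group G'"
proof (rule groupI)
  show "\<exists>y\<in>carrier G'. y \<otimes>\<^bsub>G'\<^esub> x = \<one>\<^bsub>G'\<^esub>" if x: "x \<in> carrier G'" for x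
  proof -
    from x obtain a where a: "a \<in> K" "x = \<phi> a" by (auto simp: transport_simps)
    then have "\<phi> (inv a) \<otimes>\<^bsub>G'\<^esub> x = \<one>\<^bsub>G'\<^esub>"
      using K_closed K_carrier by (auto simp: transport_simps)
    then show ?thesis using K_closed a by (auto simp: transport_simps)
  qed
qed (use K_closed K_carrier in \<open>auto simp: transport_simps m_assoc subset_iff\<close>)

lemma inv_transport: "a \<in> K \<Longrightarrow> inv\<^bsub>G'\<^esub> (\<phi> a) = \<phi> (inv a)"
  by (rule group.inv_equality[OF group_transport_group])
     (use K_closed K_carrier in \<open>auto simp: transport_simps\<close>)

lemma signed_elements_transport:
  assumes "\<And>i. i \<in> {1..n} \<Longrightarrow> A i \<in> K"
  shows "signed_elements G' n (\<lambda>i. \<phi> (A i)) = image_mset \<phi> (signed_elements G n A)"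
proof -
  have "image_mset (\<lambda>i. inv\<^bsub>G'\<^esub> (\<phi> (A i))) (mset_set {1..n})
      = image_mset (\<lambda>i. \<phi> (inv (A i))) (mset_set {1..n})"
    by (rule image_mset_cong) (use assms in \<open>auto simp: inv_transport\<close>)
  then show ?thesis by (simp add: signed_elements_def multiset.map_comp comp_def)
qed

lemma foldr_transport:
  assumes "set xs \<subseteq> K"
  shows "foldr (\<otimes>) xs \<one> \<in> K"
    and "foldr (\<otimes>\<^bsub>G'\<^esub>) (map \<phi> xs) \<one>\<^bsub>G'\<^esub> = \<phi> (foldr (\<otimes>) xs \<one>)"
  using assms by (induction xs) (auto simp: K_closed transport_simps)

lemma ordered_prod_transport:
  assumes "\<And>i. i \<in> {1..n} \<Longrightarrow> x i \<in> K"
  shows "ordered_prod G n x \<in> K"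
    and "ordered_prod G' n (\<lambda>i. \<phi> (x i)) = \<phi> (ordered_prod G n x)"
proof -
  have xs: "set (map x [1..<Suc n]) \<subseteq> K" using assms by auto
  show "ordered_prod G n x \<in> K"
    unfolding ordered_prod_def by (rule foldr_transport(1)[OF xs])
  show "ordered_prod G' n (\<lambda>i. \<phi> (x i)) = \<phi> (ordered_prod G n x)"
    unfolding ordered_prod_def foldr_transport(2)[OF xs, symmetric] by (simp del: upt_Suc add: comp_def)
qed

text \<open>Carries the conclusion back from the copy: the bijection preserves the order of the
  subgroup.\<close>

lemma subgroup_transport_vimage:
  assumes "subgroup H' G'"
  defines "H \<equiv> {x \<in> K. \<phi> x \<in> H'}"
  shows "subgroup H G" "bij_betw \<phi> H H'"
proof -
  have H': "H' \<subseteq> \<phi> ` K" using subgroup.subset[OF assms(1)] by (simp add: transport_simps)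
  show "subgroup H G"
  proof (rule subgroupI)
    show "H \<subseteq> carrier G" using K_carrier by (auto simp: H_def)
    show "H \<noteq> {}"
      using subgroup.one_closed[OF assms(1)] K_closed by (auto simp: H_def transport_simps)
    show "inv a \<in> H" if "a \<in> H" for a
      using that subgroup.m_inv_closed[OF assms(1), of "\<phi> a"] K_closed
      by (auto simp: H_def inv_transport)
    show "a \<otimes> b \<in> H" if "a \<in> H" "b \<in> H" for a b
      using that subgroup.m_closed[OF assms(1), of "\<phi> a" "\<phi> b"] K_closed
      by (auto simp: H_def transport_simps)
  qed
  show "bij_betw \<phi> H H'"
    using inj H' by (auto simp: bij_betw_def H_def inj_on_def)
qed

text \<open>The map \<open>c\<close> compresses a sample point into a code from which
  \<open>Y\<close> reads off the relabelled values. Restricting the new space to actual codes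
  ensures that each \<open>Y i\<close> takes values in the relabelled list.\<close>

lemma iid_transport:
  fixes M :: "'w measure" and c :: "'w \<Rightarrow> 'v" and Y :: "nat \<Rightarrow> 'v \<Rightarrow> 'b"
  assumes n: "n \<ge> 1" and A: "\<And>i. i \<in> {1..n} \<Longrightarrow> A i \<in> K"
    and iid: "iid_uniform_signed G n A M X"
    and c: "c \<in> measurable M (count_space (c ` space M))"
    and Y: "\<And>i \<omega>. i \<in> {1..n} \<Longrightarrow> Y i (c \<omega>) = \<phi> (X i \<omega>)"
  shows "iid_uniform_signed G' n (\<lambda>i. \<phi> (A i)) (distr M (count_space (c ` space M)) c) Y"
proof -
  let ?S = "signed_elements G n A" and ?S' = "signed_elements G' n (\<lambda>i. \<phi> (A i))"
  let ?N = "count_space (c ` space M)"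
  have S': "?S' = image_mset \<phi> ?S" by (rule signed_elements_transport[OF A])
  have ne: "?S \<noteq> {#}" using size_signed_elements[of G n A] n by auto
  interpret prob_space M using iid by (simp add: iid_uniform_signed_def)
  have indep: "indep_vars (\<lambda>_. count_space (set_mset ?S)) X {1..n}"
    using iid by (simp add: iid_uniform_signed_def)
  have rv: "X i \<in> measurable M (count_space (set_mset ?S))" if "i \<in> {1..n}" for i
    using indep that by (simp add: indep_vars_def)
  have Ym: "Y i \<in> measurable ?N (count_space (set_mset ?S'))" if i: "i \<in> {1..n}" for i
    using measurable_space[OF rv[OF i]] Y[OF i] by (auto simp: S')
  have "indep_vars (\<lambda>_. count_space (set_mset ?S')) (\<lambda>i \<omega>. \<phi> (X i \<omega>)) {1..n}"
    by (rule indep_vars_compose2[OF indep]) (auto simp: S')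
  then have "indep_vars (\<lambda>_. count_space (set_mset ?S')) (\<lambda>i \<omega>. Y i (c \<omega>)) {1..n}"
    by (rule indep_vars_cong[THEN iffD1, rotated -1]) (auto simp: Y)
  then have "prob_space.indep_vars (distr M ?N c) (\<lambda>_. count_space (set_mset ?S')) Y {1..n}"
    by (intro indep_vars_distr prob_space_axioms c Ym)
  moreover have "distr (distr M ?N c) (count_space UNIV) (Y i) = measure_pmf (pmf_of_multiset ?S')"
    if i: "i \<in> {1..n}" for i
  proof -
    have rv': "X i \<in> measurable M (count_space UNIV)"
      by (rule measurable_compose[where g = "\<lambda>x. x", OF rv[OF i]]) simp
    have "distr (distr M ?N c) (count_space UNIV) (Y i) = distr M (count_space UNIV) (\<lambda>\<omega>. Y i (c \<omega>))"
      by (subst distr_distr) (auto simp: comp_def c)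
    also have "\<dots> = distr M (count_space UNIV) (\<lambda>\<omega>. \<phi> (X i \<omega>))"
      by (rule distr_cong) (auto simp: Y[OF i])
    also have "\<dots> = distr (distr M (count_space UNIV) (X i)) (count_space UNIV) \<phi>"
      by (subst distr_distr) (auto simp: comp_def rv')
    also have "distr M (count_space UNIV) (X i) = measure_pmf (pmf_of_multiset ?S)"
      using iid i by (simp add: iid_uniform_signed_def)
    also have "distr (measure_pmf (pmf_of_multiset ?S)) (count_space UNIV) \<phi>
        = measure_pmf (map_pmf \<phi> (pmf_of_multiset ?S))"
      by (simp add: map_pmf_rep_eq)
    finally show ?thesis by (simp add: map_pmf_of_multiset[OF ne] S')
  qed
  ultimately show ?thesis
    unfolding iid_uniform_signed_def using prob_space_distr[OF c] by blast
qed

end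

text \<open>The head takes countably many values, and on each set where it is constant the list is a
  function of its tail.\<close>

lemma measurable_encoded_list:
  fixes f :: "'i \<Rightarrow> 'w \<Rightarrow> 'b::countable"
  assumes "\<And>i. i \<in> set l \<Longrightarrow> f i \<in> measurable M (count_space UNIV)"
  shows "(\<lambda>\<omega>. map (\<lambda>i. f i \<omega>) l) \<in> measurable M (count_space UNIV)"
  using assms
proof (induction l)
  case (Cons a l)
  have tail: "(\<lambda>\<omega>. map (\<lambda>i. f i \<omega>) l) \<in> measurable M (count_space UNIV)"
    using Cons by auto
  have "(\<lambda>\<omega>. f a \<omega> # map (\<lambda>i. f i \<omega>) l) \<in> measurable M (count_space UNIV)"
  proof (rule measurable_compose_countable[where f = "\<lambda>b \<omega>. b # map (\<lambda>i. f i \<omega>) l"])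
    show "(\<lambda>\<omega>. b # map (\<lambda>i. f i \<omega>) l) \<in> measurable M (count_space UNIV)" for b
      by (rule measurable_compose[OF tail]) simp
  qed (use Cons in auto)
  then show ?case by simp
qed simp

text \<open>The instance is rebuilt on \<open>nat\<close>: the group becomes a numbered copy of the
  countable subgroup generated by the \<open>A i\<close>, and a sample point becomes the code of its
  finite list of values. The subgroup \<open>H'\<close> obtained there is pulled back.\<close>

lemma admissible_constant_transfer:
  assumes adm: "admissible_constant TYPE(nat) TYPE(nat) C"
  shows "admissible_constant TYPE('g) TYPE('w) C"
  unfolding admissible_constant_def
proof (intro allI impI)
  fix n :: nat and \<epsilon> :: real and G :: "'g monoid" and A :: "nat \<Rightarrow> 'g"
    and M :: "'w measure" and X :: "nat \<Rightarrow> 'w \<Rightarrow> 'g"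
  assume n: "n \<ge> 2" and \<epsilon>: "0 < \<epsilon>" "\<epsilon> \<le> 1" and large: "real n \<ge> C / \<epsilon> ^ 4"
    and G: "group G" and A: "\<forall>i\<in>{1..n}. A i \<in> carrier G"
    and iid: "iid_uniform_signed G n A M X"
    and conc: "(SUP B\<in>carrier G. measure M {\<omega> \<in> space M. ordered_prod G n (\<lambda>i. X i \<omega>) = B})
      > 1 / (\<epsilon> * sqrt (real n))"
  interpret group G by fact
  define K where "K = generate G (A ` {1..n})"
  define \<phi> where "\<phi> = to_nat_on K"
  have gens: "A ` {1..n} \<subseteq> carrier G" using A by auto
  have "countable K" unfolding K_def by (rule countable_generate) (use gens in auto)
  interpret group_transport G K \<phi>
  proof (intro group_transport.intro plain_group.intro group_transport_axioms.intro G)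
    show "subgroup K G" unfolding K_def by (rule generate_is_subgroup[OF gens])
    show "inj_on \<phi> K" unfolding \<phi>_def by (rule inj_on_to_nat_on) fact
  qed
  have AK: "A i \<in> K" if "i \<in> {1..n}" for i
    unfolding K_def using that by (intro generate.incl) auto
  interpret prob_space M using iid by (simp add: iid_uniform_signed_def)
  have rv: "X i \<in> measurable M (count_space (set_mset (signed_elements G n A)))" if "i \<in> {1..n}" for i
    using iid that by (simp add: iid_uniform_signed_def indep_vars_def)
  have XK: "X i \<omega> \<in> K" if "i \<in> {1..n}" "\<omega> \<in> space M" for i \<omega>
    using measurable_space[OF rv[OF that(1)] that(2)] AK K_closed
    by (auto simp: set_signed_elements)
  define c where "c \<omega> = to_nat (map (\<lambda>i. \<phi> (X i \<omega>)) [1..<Suc n])" for \<omega>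
  \<comment> \<open>List positions start at 0 while the variables are numbered from 1, hence
    \<open>i - 1\<close>.\<close>
  define Y where "Y i m = (from_nat m :: nat list) ! (i - 1)" for i m
  have Y: "Y i (c \<omega>) = \<phi> (X i \<omega>)" if "i \<in> {1..n}" for i \<omega>
    using that by (auto simp: Y_def c_def simp del: upt_Suc)
  have c_UNIV: "c \<in> measurable M (count_space UNIV)"
    unfolding c_def
  proof (rule measurable_compose[OF measurable_encoded_list])
    show "(\<lambda>\<omega>. \<phi> (X i \<omega>)) \<in> measurable M (count_space UNIV)" if "i \<in> set [1..<Suc n]" for i
      by (rule measurable_compose[OF rv]) (use that in auto)
  qed simp
  have c: "c \<in> measurable M (count_space (c ` space M))"
    by (rule measurableI) (use measurable_sets[OF c_UNIV] in auto)
  define M' where "M' = distr M (count_space (c ` space M)) c"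
  have n1: "n \<ge> 1" using n by simp
  have iid': "iid_uniform_signed G' n (\<lambda>i. \<phi> (A i)) M' Y"
    unfolding M'_def by (rule iid_transport[OF n1 AK iid c Y])
  obtain B where B: "B \<in> carrier G"
    "1 / (\<epsilon> * sqrt (real n)) < measure M {\<omega> \<in> space M. ordered_prod G n (\<lambda>i. X i \<omega>) = B}"
    using ordered_prod_concentration_point[OF G prob_space_axioms conc] by blast
  \<comment> \<open>A nonnegative threshold forces the event at \<open>B\<close> to be nonempty.
    Hence \<open>B\<close> is a product of values in \<open>K\<close> and has a counterpart
    \<open>\<phi> B\<close> in the copy.\<close>
  have "0 \<le> 1 / (\<epsilon> * sqrt (real n))" using \<epsilon> by simp
  then have "{\<omega> \<in> space M. ordered_prod G n (\<lambda>i. X i \<omega>) = B} \<noteq> {}"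
    using B(2) by (metis less_le_not_le measure_empty)
  then obtain \<omega> where "\<omega> \<in> space M" "ordered_prod G n (\<lambda>i. X i \<omega>) = B" by auto
  then have BK: "B \<in> K" using ordered_prod_transport(1)[of n "\<lambda>i. X i \<omega>"] XK by auto
  interpret M': prob_space M' using iid' by (simp add: iid_uniform_signed_def)
  let ?P' = "\<lambda>B. measure M' {m \<in> space M'. ordered_prod G' n (\<lambda>i. Y i m) = B}"
  have "?P' (\<phi> B) = measure M {\<omega> \<in> space M. ordered_prod G n (\<lambda>i. X i \<omega>) = B}"
  proof -
    have "?P' (\<phi> B) = measure M (c -` {m \<in> space M'. ordered_prod G' n (\<lambda>i. Y i m) = \<phi> B} \<inter> space M)"
      unfolding M'_def by (rule measure_distr[OF c]) auto
    also have "c -` {m \<in> space M'. ordered_prod G' n (\<lambda>i. Y i m) = \<phi> B} \<inter> space M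
        = {\<omega> \<in> space M. ordered_prod G n (\<lambda>i. X i \<omega>) = B}"
    proof -
      have "ordered_prod G' n (\<lambda>i. Y i (c \<omega>)) = \<phi> B \<longleftrightarrow> ordered_prod G n (\<lambda>i. X i \<omega>) = B"
        if \<omega>: "\<omega> \<in> space M" for \<omega>
      proof -
        have "ordered_prod G' n (\<lambda>i. Y i (c \<omega>)) = ordered_prod G' n (\<lambda>i. \<phi> (X i \<omega>))"
          unfolding ordered_prod_def by (intro arg_cong2[where f = "foldr _"] map_cong refl) (auto simp: Y)
        also have "\<dots> = \<phi> (ordered_prod G n (\<lambda>i. X i \<omega>))"
          using XK \<omega> by (intro ordered_prod_transport(2)) auto
        finally show ?thesis
          using inj BK ordered_prod_transport(1)[of n "\<lambda>i. X i \<omega>"] XK \<omega> by (auto simp: inj_on_eq_iff)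
      qed
      then show ?thesis by (auto simp: M'_def)
    qed
    finally show ?thesis .
  qed
  \<comment> \<open>The point \<open>\<phi> B\<close> witnesses the concentration hypothesis in the
    copy.\<close>
  moreover have "?P' (\<phi> B) \<le> (SUP B\<in>carrier G'. ?P' B)"
    by (rule cSUP_upper) (use BK in \<open>auto simp: transport_simps intro!: bdd_aboveI2[where M = 1]\<close>)
  ultimately have conc': "(SUP B\<in>carrier G'. ?P' B) > 1 / (\<epsilon> * sqrt (real n))"
    using B(2) by linarith
  have A': "\<forall>i\<in>{1..n}. \<phi> (A i) \<in> carrier G'" using AK by (auto simp: transport_simps)
  obtain H' where H': "subgroup H' G'" "finite H'" "real (card H') \<le> C * \<epsilon> * sqrt (real n)"
    "real (card {i \<in> {1..n}. \<phi> (A i) \<in> H'}) \<ge> (1 - C * \<epsilon>\<^sup>2) * real n"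
    using adm[unfolded admissible_constant_def, rule_format, OF n \<epsilon> large group_transport_group _ iid' conc'] A'
    by blast
  define H where "H = {x \<in> K. \<phi> x \<in> H'}"
  note H = subgroup_transport_vimage[OF H'(1), folded H_def]
  have "finite H" "card H = card H'"
    using bij_betw_finite[OF H(2)] bij_betw_same_card[OF H(2)] H'(2) by auto
  moreover have "{i \<in> {1..n}. A i \<in> H} = {i \<in> {1..n}. \<phi> (A i) \<in> H'}"
    using AK by (auto simp: H_def)
  ultimately show "\<exists>H. subgroup H G \<and> finite H \<and> real (card H) \<le> C * \<epsilon> * sqrt (real n) \<and>
      real (card {i \<in> {1..n}. A i \<in> H}) \<ge> (1 - C * \<epsilon>\<^sup>2) * real n"
    using H(1) H'(3,4) by (intro exI[of _ H]) simp
qed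

theorem theorem1p15:
  shows "(\<exists>C>0. admissible_constant TYPE(nat) TYPE(nat) C) \<and>
         (\<forall>C>0. admissible_constant TYPE(nat) TYPE(nat) C
              \<longrightarrow> admissible_constant TYPE('g) TYPE('w) C)"
  using admissible_constant_16392 admissible_constant_transfer
  by (intro conjI exI[of _ 16392]) auto

end
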